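(* Let $k\ge 0$ be an integer and let $G$ be a finite graph. Then $G$ has an $\mathrm{Aut}(G)$-invariant tree-decomposition of adhesion at most $k$ that efficiently distinguishes every two distinct $k$-blocks of $G$.
   Context: A set $X$ of vertices of $G$ is $k$-inseparable in $G$ if $|X|>k$ and no set $S$ of at most $k$ vertices separates two vertices of $X\setminus S$ in $G$. A $k$-block of $G$ is a maximal $k$-inseparable set of vertices. A tree-decomposition of $G$ is a pair $(\mathcal T,\mathcal V)$ of a tree $\mathcal T$ and a family $\mathcal V=(V_t)_{t\in \mathcal T}$ of vertex sets $V_t\subseteq V(G)$ (its parts) such that: (T1) $V(G)=\bigcup_t V_t$; (T2) every edge of $G$ has both ends in some $V_t$; (T3) $V_{t_1}\cap V_{t_3}\subseteq V_{t_2}$ whenever $t_2$ lies on the $t_1$–$t_3$ path in $\mathcal T$. Its adhesion sets are the sets $V_t\cap V_{t'}$ with $tt'$ an edge of $\mathcal T$; its adhesion is the maximum size of an adhesion set ($0$ if $\mathcal T$ has no edge). A tree-decomposition of adhesion at most $k$ distinguishes two $k$-blocks $b_1,b_2$ if they are contained in different parts, $V_{t_1}$ and $V_{t_2}$ say. It does so efficiently if the $t_1$–$t_2$ path in $\mathcal T$ has an edge $tt'$ whose adhesion set $V_t\cap V_{t'}$ has size $\kappa(b_1,b_2)$, the minimum size of a $b_1$–$b_2$ separator in $G$ (a set of vertices meeting every path in $G$ from $b_1$ to $b_2$). The tree-decomposition is $\mathrm{Aut}(G)$-invariant if the automorphisms of $G$ act on the set of parts in a way that induces an action on the tree $\mathcal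 T$: there is an action $t\mapsto t^\alpha$ of $\mathrm{Aut}(G)$ on $\mathcal T$ by tree automorphisms such that $V_{t^\alpha}=\alpha(V_t)$ for all nodes $t$ and all $\alpha\in\mathrm{Aut}(G)$. *)

theory Defs
  imports "Graph_Theory.Graph_Theory" "HOL-Combinatorics.Permutations"
begin

text \<open>
  Undirected simple graphs are loopless symmetric digraphs whose arcs are pairs of vertices: an
  undirected edge \<open>uv\<close> is represented by the two arcs \<open>(u, v)\<close> and \<open>(v, u)\<close>. Finite graphs satisfy
  \<^const>\<open>pair_graph\<close>; the null graph is allowed. Paths are given by their vertex sequences
  (\<^const>\<open>vpath\<close>), so a single vertex is a path.
\<close>

section \<open>Separators and blocks\<close>

definition separator :: "'a pair_pre_digraph \<Rightarrow> 'a set \<Rightarrow> 'a set \<Rightarrow> 'a set \<Rightarrow> bool" where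
  "separator G A B S \<longleftrightarrow>
     S \<subseteq> pverts G \<and>
     (\<forall>p. vpath p (with_proj G) \<and> hd p \<in> A \<and> last p \<in> B \<longrightarrow> set p \<inter> S \<noteq> {})"

definition kappa :: "'a pair_pre_digraph \<Rightarrow> 'a set \<Rightarrow> 'a set \<Rightarrow> nat" where
  "kappa G A B = (LEAST n. \<exists>S. separator G A B S \<and> card S = n)"

definition inseparable :: "'a pair_pre_digraph \<Rightarrow> nat \<Rightarrow> 'a set \<Rightarrow> bool" where
  "inseparable G k X \<longleftrightarrow>
     X \<subseteq> pverts G \<and> card X > k \<and>
     \<not> (\<exists>S. S \<subseteq> pverts G \<and> card S \<le> k \<and>
          (\<exists>x\<in>X - S. \<exists>y\<in>X - S. x \<noteq> y \<and> separator G {x} {y} S))"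

definition block :: "'a pair_pre_digraph \<Rightarrow> nat \<Rightarrow> 'a set \<Rightarrow> bool" where
  "block G k b \<longleftrightarrow> inseparable G k b \<and> (\<forall>Y. inseparable G k Y \<and> b \<subseteq> Y \<longrightarrow> Y = b)"

section \<open>Tree-decompositions\<close>

text \<open>
  The library predicate \<^const>\<open>tree\<close> is not suitable for symmetric digraphs: it regards the two
  opposite arcs of an undirected edge as a cycle. The cycles of an undirected simple graph are the
  directed cycles of length at least 3. Connectedness includes that there is at least one node.
\<close>

definition undirected_tree :: "'t pair_pre_digraph \<Rightarrow> bool" where
  "undirected_tree T \<longleftrightarrow>
     pair_bidirected_digraph T \<and> connected (with_proj T) \<and>
     \<not> (\<exists>c. pre_digraph.cycle (with_proj T) c \<and> length c \<ge> 3)"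

definition tree_decomposition ::
    "'a pair_pre_digraph \<Rightarrow> 't pair_pre_digraph \<Rightarrow> ('t \<Rightarrow> 'a set) \<Rightarrow> bool" where
  "tree_decomposition G T V \<longleftrightarrow>
     undirected_tree T \<and>
     pverts G = (\<Union>t\<in>pverts T. V t) \<and>
     (\<forall>(u, v)\<in>parcs G. \<exists>t\<in>pverts T. u \<in> V t \<and> v \<in> V t) \<and>
     (\<forall>p. vpath p (with_proj T) \<longrightarrow> (\<forall>t\<in>set p. V (hd p) \<inter> V (last p) \<subseteq> V t))"

definition adhesion_sets :: "'t pair_pre_digraph \<Rightarrow> ('t \<Rightarrow> 'a set) \<Rightarrow> 'a set set" where
  "adhesion_sets T V = {V t \<inter> V t' | t t'. (t, t') \<in> parcs T}"

definition adhesion :: "'t pair_pre_digraph \<Rightarrow> ('t \<Rightarrow> 'a set) \<Rightarrow> nat" where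
  "adhesion T V = (if parcs T = {} then 0 else Max (card ` adhesion_sets T V))"

definition distinguishes_at ::
    "'t pair_pre_digraph \<Rightarrow> ('t \<Rightarrow> 'a set) \<Rightarrow> 't \<Rightarrow> 't \<Rightarrow> 'a set \<Rightarrow> 'a set \<Rightarrow> bool" where
  "distinguishes_at T V t1 t2 b1 b2 \<longleftrightarrow>
     t1 \<in> pverts T \<and> t2 \<in> pverts T \<and> t1 \<noteq> t2 \<and> b1 \<subseteq> V t1 \<and> b2 \<subseteq> V t2"

definition efficiently_distinguishes ::
    "'a pair_pre_digraph \<Rightarrow> 't pair_pre_digraph \<Rightarrow> ('t \<Rightarrow> 'a set) \<Rightarrow> 'a set \<Rightarrow> 'a set \<Rightarrow> bool" where
  "efficiently_distinguishes G T V b1 b2 \<longleftrightarrow>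
     (\<exists>t1 t2. distinguishes_at T V t1 t2 b1 b2 \<and>
        (\<exists>p. vpath p (with_proj T) \<and> hd p = t1 \<and> last p = t2 \<and>
           (\<exists>(t, t')\<in>set (vwalk_arcs p). card (V t \<inter> V t') = kappa G b1 b2)))"

section \<open>Automorphisms and invariance\<close>

text \<open>
  Automorphisms are extended by the identity outside the vertex set, so that they form a group
  under composition of functions.
\<close>

definition Aut :: "'a pair_pre_digraph \<Rightarrow> ('a \<Rightarrow> 'a) set" where
  "Aut G = {\<alpha>. \<alpha> permutes pverts G \<and>
     (\<forall>u\<in>pverts G. \<forall>v\<in>pverts G. (\<alpha> u, \<alpha> v) \<in> parcs G \<longleftrightarrow> (u, v) \<in> parcs G)}"

text \<open>
  In the definition below, \<open>\<phi> \<alpha> t\<close> is the node \<open>t\<^sup>\<alpha>\<close>. The condition on parts makes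
  this a left action: \<open>\<alpha> \<circ> \<beta>\<close> acts by first applying \<open>\<beta>\<close>.
\<close>

definition Aut_invariant ::
    "'a pair_pre_digraph \<Rightarrow> 't pair_pre_digraph \<Rightarrow> ('t \<Rightarrow> 'a set) \<Rightarrow> bool" where
  "Aut_invariant G T V \<longleftrightarrow>
     (\<exists>\<phi> :: ('a \<Rightarrow> 'a) \<Rightarrow> 't \<Rightarrow> 't.
        (\<forall>\<alpha>\<in>Aut G. \<phi> \<alpha> \<in> Aut T) \<and>
        \<phi> id = id \<and>
        (\<forall>\<alpha>\<in>Aut G. \<forall>\<beta>\<in>Aut G. \<phi> (\<alpha> \<circ> \<beta>) = \<phi> \<alpha> \<circ> \<phi> \<beta>) \<and>
        (\<forall>\<alpha>\<in>Aut G. \<forall>t\<in>pverts T. V (\<phi> \<alpha> t) = \<alpha> ` V t))"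

end

theory Submission
  imports Defs
begin

text \<open>
  A separation is a pair \<open>(A, B)\<close> of sides covering the vertex set such that every edge lies in
  one side; its order is \<open>\<bar>A \<inter> B\<bar>\<close>. A separation of order at most \<open>k\<close> has every \<open>k\<close>-block on
  exactly one of its sides, two distinct \<open>k\<close>-blocks are always on different sides of some such
  separation, and the minimum order of a separation doing this is \<open>\<kappa>\<close>. So the theorem asks for a
  set of efficient separations (separations of minimum order for some pair of blocks) that contains
  one for every pair, is invariant under automorphisms, and is nested, that is, can be read off the
  edges of a tree.

  To find it, process the pairs of blocks by increasing order \<open>\<kappa>\<close>. For a given pair, consider the
  efficient separations that are nested with everything selected at smaller orders, and select
  all those among them that cross the fewest separations of the graph. No choice is made, so
  the result is invariant under automorphisms. That it is nested and meets every pair comes from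
  submodularity of the order at opposite corners of two crossing separations:
  \<^item> A separation of minimum order for a pair that crosses one selected at a smaller order can be
    replaced by a corner that is still of minimum order but does not cross it
    (\<open>uncross_from_lower_order\<close>). So there are always candidates (\<open>candidates_nonempty\<close>).
  \<^item> If two separations selected at the same order cross, then two opposite corners are candidates
    again. But opposite corners together cross fewer separations than the two separations do
    (\<open>crossing_number_corners\<close>), which contradicts minimality (\<open>best_nested\<close>).

  The tree of a nested set of separations has as nodes the consistent orientations of the
  set, two of them being adjacent if they differ in a single separation; the part of a node is the
  intersection of the sides to which its orientation points. Nestedness makes an edge of this graph
  determined by the separation that is reversed along it (\<open>orientation_at_flipped\<close>).
  Hence a path reverses each separation at most once, which gives both acyclicity and the path axiom
  for the parts, and the adhesion set of an edge is the separator \<open>A \<inter> B\<close> of its separation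
  (\<open>parts_across_edge\<close>). Since the construction refers to the nested set only, every automorphism
  acts on the tree.
\<close>


section \<open>Separations and their corners\<close>

type_synonym 'a sep = "'a set \<times> 'a set"

abbreviation opp :: "'a sep \<Rightarrow> 'a sep" where
  "opp \<equiv> prod.swap"

text \<open>
  For this order \<open>opp\<close> is an order-reversing involution that exchanges the lattice operations
  \<open>meet\<close> and \<open>join\<close>. The four corners of two separations are the meets of either orientation of the
  one with either orientation of the other; up to reversal, the meet and the join are opposite
  corners.
\<close>

definition sep_le :: "'a sep \<Rightarrow> 'a sep \<Rightarrow> bool" (infix "\<preceq>" 50) where
  "s \<preceq> t \<longleftrightarrow> fst s \<subseteq> fst t \<and> snd t \<subseteq> snd s"

definition meet :: "'a sep \<Rightarrow> 'a sep \<Rightarrow> 'a sep" where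
  "meet s t = (fst s \<inter> fst t, snd s \<union> snd t)"

definition join :: "'a sep \<Rightarrow> 'a sep \<Rightarrow> 'a sep" where
  "join s t = (fst s \<union> fst t, snd s \<inter> snd t)"

definition nested :: "'a sep \<Rightarrow> 'a sep \<Rightarrow> bool" where
  "nested s t \<longleftrightarrow> s \<preceq> t \<or> s \<preceq> opp t \<or> opp s \<preceq> t \<or> opp s \<preceq> opp t"

definition sep_order :: "'a sep \<Rightarrow> nat" where
  "sep_order s = card (fst s \<inter> snd s)"

lemma sep_order_opp [simp]: "sep_order (opp s) = sep_order s"
  by (simp add: sep_order_def Int_commute)

lemma sep_le_trans: "s \<preceq> t \<Longrightarrow> t \<preceq> u \<Longrightarrow> s \<preceq> u"
  by (auto simp: sep_le_def)

lemma sep_le_refl [simp]: "s \<preceq> s"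
  by (simp add: sep_le_def)

lemma sep_le_antisym: "s \<preceq> t \<Longrightarrow> t \<preceq> s \<Longrightarrow> s = t"
  by (auto simp: sep_le_def prod_eq_iff)

lemma sep_le_opp_iff: "opp s \<preceq> opp t \<longleftrightarrow> t \<preceq> s"
  by (auto simp: sep_le_def)

lemma sep_le_opp_left: "opp s \<preceq> t \<longleftrightarrow> opp t \<preceq> s"
  by (auto simp: sep_le_def)

lemma sep_le_opp_right: "s \<preceq> opp t \<longleftrightarrow> t \<preceq> opp s"
  by (auto simp: sep_le_def)

lemma nested_sym: "nested s t \<longleftrightarrow> nested t s"
  by (auto simp: nested_def sep_le_def)

lemma nested_opp_left [simp]: "nested (opp s) t \<longleftrightarrow> nested s t"
  by (auto simp: nested_def)

lemma nested_opp_right [simp]: "nested s (opp t) \<longleftrightarrow> nested s t"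
  by (auto simp: nested_def)

lemma opp_meet: "opp (meet s t) = join (opp s) (opp t)"
  by (simp add: meet_def join_def)

lemma opp_join: "opp (join s t) = meet (opp s) (opp t)"
  by (simp add: meet_def join_def)

text \<open>
  The two corner separators lie in the union of the original separators, and any vertex in
  both lies in both originals.
\<close>

lemma sep_order_submodular:
  assumes "finite (fst s \<inter> snd s)" "finite (fst t \<inter> snd t)"
  shows "sep_order (meet s t) + sep_order (join s t) \<le> sep_order s + sep_order t"
proof -
  let ?X = "fst (meet s t) \<inter> snd (meet s t)" and ?Y = "fst (join s t) \<inter> snd (join s t)"
  let ?P = "fst s \<inter> snd s" and ?Q = "fst t \<inter> snd t"
  have sub: "?X \<union> ?Y \<subseteq> ?P \<union> ?Q" "?X \<inter> ?Y \<subseteq> ?P \<inter> ?Q"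
    by (auto simp: meet_def join_def)
  have fin: "finite ?X" "finite ?Y"
    using sub(1) assms by (meson finite_Un finite_subset)+
  have "card ?X + card ?Y = card (?X \<union> ?Y) + card (?X \<inter> ?Y)"
    by (rule card_Un_Int[OF fin])
  also have "\<dots> \<le> card (?P \<union> ?Q) + card (?P \<inter> ?Q)"
    using sub assms by (intro add_mono card_mono) auto
  also have "\<dots> = card ?P + card ?Q"
    by (rule card_Un_Int[OF assms, symmetric])
  finally show ?thesis
    by (simp add: sep_order_def)
qed

text \<open>
  The hypothesis that \<open>s\<close> and \<open>t\<close> cross excludes the one configuration in which nestedness with the
  corner fails: a separation squeezed between the two, with \<open>opp t \<preceq> u \<preceq> s\<close>.
\<close>

lemma nested_corner:
  assumes "\<not> nested s t" "nested u s" "nested u t"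
  shows "nested u (meet s t)"
proof -
  consider "u \<preceq> opp s \<or> opp u \<preceq> opp s \<or> u \<preceq> opp t \<or> opp u \<preceq> opp t"
    | "u \<preceq> s" "u \<preceq> t" | "opp u \<preceq> s" "opp u \<preceq> t"
    | "u \<preceq> s" "opp u \<preceq> t" | "opp u \<preceq> s" "u \<preceq> t"
    using assms(2,3) unfolding nested_def by blast
  then show ?thesis
  proof cases
    case 4
    then have "opp s \<preceq> t" by (auto simp: sep_le_def)
    then show ?thesis using assms(1) by (simp add: nested_def)
  next
    case 5
    then have "opp s \<preceq> t" by (auto simp: sep_le_def)
    then show ?thesis using assms(1) by (simp add: nested_def)
  qed (auto simp: nested_def sep_le_def meet_def)
qed

lemma nested_corner_join:
  assumes "\<not> nested s t" "nested u s" "nested u t"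
  shows "nested u (join s t)"
  using nested_corner[of "opp s" "opp t" u] assms by (simp flip: opp_join)

lemma meet_commute: "meet s t = meet t s"
  by (simp add: meet_def Int_commute Un_commute)

lemma join_commute: "join s t = join t s"
  by (simp add: join_def Int_commute Un_commute)

text \<open>
  A separation nested with \<open>s\<close> has an orientation above or below \<open>s\<close>; the first lies above the
  meet, the second below the join.
\<close>

lemma nested_one_of_opposite_corners:
  assumes "nested u s"
  shows "nested u (meet s t) \<or> nested u (join s t)"
proof -
  have "meet s t \<preceq> s" "s \<preceq> join s t" by (auto simp: sep_le_def meet_def join_def)
  then show ?thesis
    using assms sep_le_trans[of _ s "join s t"] sep_le_trans[of "meet s t" s]
    unfolding nested_def by (metis sep_le_opp_left sep_le_opp_right sep_le_opp_iff)
qed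

lemma nested_meet_self: "nested s (meet s t)" "nested t (meet s t)"
  "nested s (join s t)" "nested t (join s t)"
  by (auto simp: nested_def sep_le_def meet_def join_def)


section \<open>A canonical nested set of efficient separations\<close>

text \<open>
  The construction uses only these properties of separations and blocks. Paths in the graph
  do not occur, which makes invariance under symmetries a matter of transporting sets.
\<close>

locale block_system =
  fixes V :: "'a set" and U :: "'a sep set" and k :: nat and \<B> :: "'a set set"
  assumes finite_V: "finite V"
    and U_sub: "U \<subseteq> Pow V \<times> Pow V"
    and opp_U: "s \<in> U \<Longrightarrow> opp s \<in> U"
    and meet_U: "s \<in> U \<Longrightarrow> t \<in> U \<Longrightarrow> meet s t \<in> U"
    and block_large: "b \<in> \<B> \<Longrightarrow> k < card b"
    and block_side: "b \<in> \<B> \<Longrightarrow> s \<in> U \<Longrightarrow> sep_order s \<le> k \<Longrightarrow> b \<subseteq> fst s \<or> b \<subseteq> snd s"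
    and blocks_separated: "b \<in> \<B> \<Longrightarrow> b' \<in> \<B> \<Longrightarrow> b \<noteq> b' \<Longrightarrow>
      \<exists>s\<in>U. sep_order s \<le> k \<and> b \<subseteq> fst s \<and> b' \<subseteq> snd s"
begin

lemma join_U: "s \<in> U \<Longrightarrow> t \<in> U \<Longrightarrow> join s t \<in> U"
  using meet_U[of "opp s" "opp t"] opp_U[of "meet (opp s) (opp t)"] opp_U
  by (simp add: opp_meet)

lemma finite_U: "finite U"
  using U_sub finite_V by (meson finite_Pow_iff finite_SigmaI finite_subset)

lemma finite_separator: "s \<in> U \<Longrightarrow> finite (fst s \<inter> snd s)"
  using finite_V by (auto dest!: subsetD[OF U_sub] dest: finite_subset)

lemma submodular:
  assumes "s \<in> U" "t \<in> U"
  shows "sep_order (meet s t) + sep_order (join s t) \<le> sep_order s + sep_order t"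
  using assms by (intro sep_order_submodular finite_separator)

text \<open>
  The pairs of blocks are ordered, and \<open>dist b b'\<close> consists of the distinguishing separations that
  point from \<open>b\<close> to \<open>b'\<close>; reversing a separation swaps the pair.
\<close>

definition dist :: "'a set \<Rightarrow> 'a set \<Rightarrow> 'a sep set" where
  "dist b b' = {s \<in> U. b \<subseteq> fst s \<and> b' \<subseteq> snd s}"

definition min_order :: "'a set \<Rightarrow> 'a set \<Rightarrow> nat" where
  "min_order b b' = (LEAST n. \<exists>s\<in>dist b b'. sep_order s = n)"

definition eff :: "'a set \<Rightarrow> 'a set \<Rightarrow> 'a sep set" where
  "eff b b' = {s \<in> dist b b'. sep_order s = min_order b b'}"

definition pair :: "'a set \<Rightarrow> 'a set \<Rightarrow> bool" where
  "pair b b' \<longleftrightarrow> b \<in> \<B> \<and> b' \<in> \<B> \<and> b \<noteq> b'"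

lemma pair_sym: "pair b b' \<Longrightarrow> pair b' b"
  by (auto simp: pair_def)

lemma opp_dist: "opp s \<in> dist b' b \<longleftrightarrow> s \<in> dist b b'"
  using opp_U[of s] opp_U[of "opp s"] by (auto simp: dist_def)

lemma min_order_sym: "min_order b b' = min_order b' b"
proof -
  have "\<exists>s\<in>dist b' b. sep_order s = n" if "s \<in> dist b b'" "sep_order s = n" for s n b b'
    using that by (intro bexI[of _ "opp s"]) (simp_all add: opp_dist)
  then have "(\<exists>s\<in>dist b b'. sep_order s = n) \<longleftrightarrow> (\<exists>s\<in>dist b' b. sep_order s = n)" for n
    by blast
  then show ?thesis by (simp add: min_order_def)
qed

lemma opp_eff: "opp s \<in> eff b' b \<longleftrightarrow> s \<in> eff b b'"
  by (simp add: eff_def opp_dist min_order_sym[of b b'])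

lemma min_order_le: "s \<in> dist b b' \<Longrightarrow> min_order b b' \<le> sep_order s"
  unfolding min_order_def by (rule Least_le) blast

lemma eff_nonempty: assumes "pair b b'" shows "eff b b' \<noteq> {}"
proof -
  have "\<exists>n. \<exists>s\<in>dist b b'. sep_order s = n"
    using blocks_separated[of b b'] assms by (auto simp: pair_def dist_def)
  then have "\<exists>s\<in>dist b b'. sep_order s = min_order b b'"
    unfolding min_order_def by (rule LeastI_ex)
  then show ?thesis by (auto simp: eff_def)
qed

lemma min_order_le_k: assumes "pair b b'" shows "min_order b b' \<le> k"
proof -
  obtain s where "s \<in> U" "sep_order s \<le> k" "b \<subseteq> fst s" "b' \<subseteq> snd s"
    using blocks_separated[of b b'] assms unfolding pair_def by blast
  then show ?thesis using min_order_le[of s b b'] by (simp add: dist_def)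
qed

lemma effD:
  assumes "s \<in> eff b b'"
  shows "s \<in> U" "b \<subseteq> fst s" "b' \<subseteq> snd s" "sep_order s = min_order b b'" "s \<in> dist b b'"
  using assms by (auto simp: eff_def dist_def)

text \<open>
  Submodularity bounds the sum of the corner orders from above and the minimum orders bound each
  corner order from below, so both bounds are attained.
\<close>

lemma corners_eff:
  assumes "s \<in> U" "t \<in> U" "sep_order s + sep_order t \<le> min_order p p' + min_order q q'"
    and "p \<subseteq> fst s \<inter> fst t" "p' \<subseteq> snd s \<union> snd t" "q \<subseteq> fst s \<union> fst t" "q' \<subseteq> snd s \<inter> snd t"
  shows "meet s t \<in> eff p p'" "join s t \<in> eff q q'"
proof -
  have d: "meet s t \<in> dist p p'" "join s t \<in> dist q q'"
    using assms meet_U join_U by (auto simp: dist_def meet_def join_def)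
  have "sep_order (meet s t) = min_order p p' \<and> sep_order (join s t) = min_order q q'"
    using min_order_le[OF d(1)] min_order_le[OF d(2)] submodular[OF assms(1,2)] assms(3) by linarith
  with d show "meet s t \<in> eff p p'" "join s t \<in> eff q q'" by (auto simp: eff_def)
qed

text \<open>
  Since \<open>a\<close> has smaller order than needed to distinguish \<open>b\<close> from \<open>b'\<close>, both lie on the same side of
  \<open>a\<close>. The two corners of \<open>s\<close> and \<open>a\<close> on that side both distinguish \<open>b\<close> from \<open>b'\<close>. If neither
  is efficient, then by submodularity both corners on the other side have smaller order than \<open>a\<close>,
  and one of them still distinguishes the pair \<open>c\<close>, \<open>c'\<close> for which \<open>a\<close> was efficient.
\<close>

lemma uncross_from_lower_order:
  assumes "pair b b'" "pair c c'" "min_order c c' < min_order b b'"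
    and s: "s \<in> eff b b'" and a: "a \<in> eff c c'"
  shows "\<exists>t\<in>eff b b'. nested t a \<and> (\<forall>u. nested u a \<and> nested u s \<longrightarrow> nested u t)"
proof (cases "nested s a")
  case True
  then show ?thesis using s by blast
next
  case False
  have main: "\<exists>t\<in>eff b b'. nested t a \<and> (\<forall>u. nested u a \<and> nested u s \<longrightarrow> nested u t)"
    if "pair c c'" "min_order c c' < min_order b b'" "a \<in> eff c c'"
      "\<not> nested s a" "b \<subseteq> snd a" for c c' a
  proof -
    note s' = effD[OF s] and a' = effD[OF that(3)]
    have ords: "sep_order s \<le> k" "sep_order a \<le> k"
      using s' a' min_order_le_k assms(1) that(1) by auto
    have b'a: "b' \<subseteq> snd a"
    proof (rule ccontr)
      assume "\<not> b' \<subseteq> snd a"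
      then have "b' \<subseteq> fst a" using block_side[of b' a] assms(1) a' ords by (auto simp: pair_def)
      then have "a \<in> dist b' b" using a' that(5) by (simp add: dist_def)
      then show False using min_order_le[of a b' b] min_order_sym[of b b'] that(2) a' by simp
    qed
    \<comment> \<open>\<open>?t\<close> and \<open>?t'\<close> are the corners on the side of \<open>a\<close> containing both blocks; \<open>?c\<close> and \<open>?c'\<close>
      are opposite to them.\<close>
    let ?t = "meet (opp a) s" and ?t' = "meet (opp a) (opp s)"
    let ?c = "join (opp a) s" and ?c' = "join (opp a) (opp s)"
    have d: "?t \<in> dist b b'" "?t' \<in> dist b' b"
      using s' a' that(5) b'a meet_U opp_U by (auto simp: dist_def meet_def)
    have nest: "nested ?t a" "nested ?t' a"
      using nested_meet_self(1)[of "opp a"] by (simp_all add: nested_sym[of _ a])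
    have nest': "nested u ?t" "nested u ?t'" if "nested u a" "nested u s" for u
      using nested_corner[of "opp a" s u] nested_corner[of "opp a" "opp s" u]
        that \<open>\<not> nested s a\<close> nested_sym[of s a] by auto
    consider "sep_order ?t = min_order b b'" | "sep_order ?t' = min_order b b'"
      | "sep_order ?t > min_order b b'" "sep_order ?t' > min_order b b'"
      using min_order_le[OF d(1)] min_order_le[OF d(2)] min_order_sym[of b b'] by linarith
    then show ?thesis
    proof cases
      case 1
      then have "?t \<in> eff b b'" using d by (simp add: eff_def)
      then show ?thesis using nest nest' by (intro bexI[of _ ?t]) auto
    next
      case 2
      then have "?t' \<in> eff b' b" using d by (simp add: eff_def min_order_sym[of b b'])
      then have "opp ?t' \<in> eff b b'" by (simp only: opp_eff)
      then show ?thesis using nest nest' by (intro bexI[of _ "opp ?t'"]) auto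
    next
      case 3
      have small: "sep_order ?c < min_order c c'" "sep_order ?c' < min_order c c'"
        using submodular[of "opp a" s] submodular[of "opp a" "opp s"] 3 s' a' opp_U by auto
      have "c \<subseteq> fst s \<or> c \<subseteq> snd s"
        using block_side[of c s] that(1) s' ords by (auto simp: pair_def)
      then have "opp ?c \<in> dist c c' \<or> opp ?c' \<in> dist c c'"
      proof
        assume "c \<subseteq> snd s"
        then have "opp ?c \<in> dist c c'"
          using a' s' join_U opp_U by (auto simp: dist_def) (auto simp: join_def)
        then show ?thesis ..
      next
        assume "c \<subseteq> fst s"
        then have "opp ?c' \<in> dist c c'"
          using a' s' join_U opp_U by (auto simp: dist_def) (auto simp: join_def)
        then show ?thesis ..
      qed
      then show ?thesis
        using small min_order_le[of "opp ?c" c c'] min_order_le[of "opp ?c'" c c'] by auto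
    qed
  qed
  have "b \<subseteq> snd a \<or> b \<subseteq> fst a"
    using block_side[of b a] assms effD[OF a] min_order_le_k by (auto simp: pair_def)
  then show ?thesis
  proof
    assume "b \<subseteq> snd a"
    then show ?thesis using main[of c c' a] assms False by blast
  next
    assume "b \<subseteq> fst a"
    then show ?thesis
      using main[of c' c "opp a"] assms False pair_sym min_order_sym[of c c'] by (simp add: opp_eff)
  qed
qed

definition crossing_number :: "'a sep \<Rightarrow> nat" where
  "crossing_number s = card {u \<in> U. \<not> nested u s}"

lemma crossing_number_opp [simp]: "crossing_number (opp s) = crossing_number s"
  by (simp add: crossing_number_def)

text \<open>
  The separations crossing a corner cross \<open>s\<close> or \<open>t\<close>, and those crossing both corners cross both.
  The inequality is strict because \<open>s\<close> itself crosses \<open>t\<close> but neither corner.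
\<close>

lemma crossing_number_corners:
  assumes "s \<in> U" "t \<in> U" "\<not> nested s t"
  shows "crossing_number (meet s t) + crossing_number (join s t)
    < crossing_number s + crossing_number t"
proof -
  let ?X = "\<lambda>s. {u \<in> U. \<not> nested u s}"
  let ?M = "?X (meet s t)" and ?J = "?X (join s t)"
  have fin: "finite (?X s)" for s using finite_U by simp
  have "?M \<inter> ?J \<subseteq> ?X s \<inter> ?X t"
    using nested_one_of_opposite_corners[of _ s t] nested_one_of_opposite_corners[of _ t s]
    by (auto simp: meet_commute[of t s] join_commute[of t s])
  then have inter: "card (?M \<inter> ?J) \<le> card (?X s \<inter> ?X t)"
    using fin by (intro card_mono) auto
  have "?M \<union> ?J \<subseteq> ?X s \<union> ?X t"
    using nested_corner[OF assms(3)] nested_corner_join[OF assms(3)] by blast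
  moreover have "s \<in> ?X s \<union> ?X t" "s \<notin> ?M \<union> ?J"
    using assms nested_meet_self[where s = s and t = t] by auto
  ultimately have "?M \<union> ?J \<subset> ?X s \<union> ?X t" by blast
  then have union: "card (?M \<union> ?J) < card (?X s \<union> ?X t)"
    using fin by (intro psubset_card_mono) auto
  have "card ?M + card ?J = card (?M \<union> ?J) + card (?M \<inter> ?J)"
    "card (?X s) + card (?X t) = card (?X s \<union> ?X t) + card (?X s \<inter> ?X t)"
    by (rule card_Un_Int[OF fin fin])+
  then show ?thesis
    using inter union by (simp add: crossing_number_def)
qed

definition candidates :: "'a sep set \<Rightarrow> 'a set \<Rightarrow> 'a set \<Rightarrow> 'a sep set" where
  "candidates M b b' = {s \<in> eff b b'. \<forall>t\<in>M. nested s t}"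

definition best :: "'a sep set \<Rightarrow> 'a set \<Rightarrow> 'a set \<Rightarrow> 'a sep set" where
  "best M b b' = {s \<in> candidates M b b'. \<forall>t\<in>candidates M b b'. crossing_number s \<le> crossing_number t}"

lemma opp_candidates: "opp s \<in> candidates M b' b \<longleftrightarrow> s \<in> candidates M b b'"
  by (simp add: candidates_def opp_eff)

lemma opp_best: "opp s \<in> best M b' b \<longleftrightarrow> s \<in> best M b b'"
proof -
  have "opp s \<in> best M b' b" if "s \<in> best M b b'" for s b b'
    unfolding best_def
  proof (intro CollectI conjI ballI)
    show "opp s \<in> candidates M b' b" using that by (simp add: opp_candidates best_def)
    fix t assume "t \<in> candidates M b' b"
    then have "opp t \<in> candidates M b b'" by (simp add: opp_candidates)
    then have "crossing_number s \<le> crossing_number (opp t)" using that by (simp only: best_def mem_Collect_eq)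
    then show "crossing_number (opp s) \<le> crossing_number t" by simp
  qed
  from this[of s b b'] this[of "opp s" b' b] show ?thesis by auto
qed

text \<open>
  The hypotheses place \<open>p\<close> in the corner \<open>meet s t\<close> and \<open>q'\<close> in the opposite corner, so each corner
  distinguishes one of the two pairs and is a candidate for it.
\<close>

lemma no_best_corner_pair:
  assumes s: "s \<in> best M p p'" and t: "t \<in> best M q q'" and mo: "min_order p p' = min_order q q'"
    and "p \<subseteq> fst t" "q' \<subseteq> snd s"
  shows "nested s t"
proof (rule ccontr)
  assume cross: "\<not> nested s t"
  have s': "s \<in> eff p p'" "\<forall>u\<in>M. nested s u" and t': "t \<in> eff q q'" "\<forall>u\<in>M. nested t u"
    using s t by (auto simp: best_def candidates_def)
  note sD = effD[OF s'(1)] and tD = effD[OF t'(1)]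
  have "meet s t \<in> eff p p'" "join s t \<in> eff q q'"
    using corners_eff[of s t p p' q q'] sD tD assms(4,5) by auto
  moreover have "nested (meet s t) u" "nested (join s t) u" if "u \<in> M" for u
    using nested_corner[OF cross, of u] nested_corner_join[OF cross, of u] s'(2) t'(2) that
    by (auto simp: nested_sym)
  ultimately have "meet s t \<in> candidates M p p'" "join s t \<in> candidates M q q'"
    by (auto simp: candidates_def)
  then have "crossing_number s \<le> crossing_number (meet s t)"
      "crossing_number t \<le> crossing_number (join s t)"
    using s t by (auto simp: best_def)
  then show False using crossing_number_corners[OF sD(1) tD(1) cross] by simp
qed

text \<open>
  Here both opposite corners distinguish the pair for which \<open>s\<close> is optimal, so the
  whole deficit of the corners has to be taken from \<open>t\<close>.
\<close>

lemma crossing_number_less_if_same_pair: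
  assumes s: "s \<in> best M p p'" and t: "t \<in> U" "sep_order t = min_order p p'" "\<forall>u\<in>M. nested t u"
    and "p \<subseteq> fst t" "p' \<subseteq> snd t" and cross: "\<not> nested s t"
  shows "crossing_number s < crossing_number t"
proof -
  have s': "s \<in> eff p p'" "\<forall>u\<in>M. nested s u"
    using s by (auto simp: best_def candidates_def)
  note sD = effD[OF s'(1)]
  have "meet s t \<in> eff p p'" "join s t \<in> eff p p'"
    using corners_eff[of s t p p' p p'] sD t assms(5,6) by auto
  moreover have "nested (meet s t) u" "nested (join s t) u" if "u \<in> M" for u
    using nested_corner[OF cross, of u] nested_corner_join[OF cross, of u] s'(2) t(3) that
    by (auto simp: nested_sym)
  ultimately have "meet s t \<in> candidates M p p'" "join s t \<in> candidates M p p'"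
    by (auto simp: candidates_def)
  then have "crossing_number s \<le> crossing_number (meet s t)"
      "crossing_number s \<le> crossing_number (join s t)"
    using s by (auto simp: best_def)
  then show ?thesis using crossing_number_corners[OF sD(1) t(1) cross] by simp
qed

text \<open>
  If no two opposite corners serve the two pairs as in \<open>no_best_corner_pair\<close>, then \<open>p\<close>, \<open>p'\<close>
  lie in one pair of opposite corners and \<open>q\<close>, \<open>q'\<close> in the other. Then \<open>s\<close> and \<open>t\<close> each distinguish
  both pairs, and each would have a smaller crossing number than the other.
\<close>

lemma best_nested:
  assumes P: "pair p p'" "pair q q'" and mo: "min_order p p' = min_order q q'"
    and s: "s \<in> best M p p'" and t: "t \<in> best M q q'"
  shows "nested s t"
proof (rule ccontr)
  assume cross: "\<not> nested s t"
  have s': "s \<in> eff p p'" "\<forall>u\<in>M. nested s u" and t': "t \<in> eff q q'" "\<forall>u\<in>M. nested t u"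
    using s t by (auto simp: best_def candidates_def)
  note sD = effD[OF s'(1)] and tD = effD[OF t'(1)]
  have os: "opp s \<in> best M p' p" and ot: "opp t \<in> best M q' q"
    using s t by (simp_all add: opp_best)
  have mo': "min_order p' p = min_order q q'" "min_order p p' = min_order q' q"
      "min_order p' p = min_order q' q"
    using mo min_order_sym by metis+
  have "p \<subseteq> fst t \<or> p \<subseteq> snd t" "p' \<subseteq> fst t \<or> p' \<subseteq> snd t"
    "q \<subseteq> fst s \<or> q \<subseteq> snd s" "q' \<subseteq> fst s \<or> q' \<subseteq> snd s"
    using block_side P sD tD min_order_le_k unfolding pair_def by metis+
  moreover have "\<not> (p \<subseteq> fst t \<and> q' \<subseteq> snd s)"
    using no_best_corner_pair[OF s t mo] cross by blast
  moreover have "\<not> (p' \<subseteq> fst t \<and> q' \<subseteq> fst s)"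
    using no_best_corner_pair[OF os t mo'(1)] cross by auto
  moreover have "\<not> (p \<subseteq> snd t \<and> q \<subseteq> snd s)"
    using no_best_corner_pair[OF s ot mo'(2)] cross by auto
  moreover have "\<not> (p' \<subseteq> snd t \<and> q \<subseteq> fst s)"
    using no_best_corner_pair[OF os ot mo'(3)] cross by auto
  ultimately consider "p \<subseteq> fst t" "p' \<subseteq> snd t" "q \<subseteq> snd s" "q' \<subseteq> fst s"
    | "p \<subseteq> snd t" "p' \<subseteq> fst t" "q \<subseteq> fst s" "q' \<subseteq> snd s"
    by blast
  then show False
  proof cases
    case 1
    have "crossing_number s < crossing_number t"
      using crossing_number_less_if_same_pair[OF s tD(1) _ t'(2) 1(1,2) cross] tD mo by simp
    moreover have "crossing_number t < crossing_number (opp s)"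
      using crossing_number_less_if_same_pair[OF t, of "opp s"] 1 cross sD s' mo opp_U
      by (simp add: nested_sym)
    ultimately show False by simp
  next
    case 2
    have "crossing_number s < crossing_number (opp t)"
      using crossing_number_less_if_same_pair[OF s, of "opp t"] 2 cross tD t' mo opp_U by simp
    moreover have "crossing_number t < crossing_number s"
      using crossing_number_less_if_same_pair[OF t, of s] 2 cross sD s' mo
      by (simp add: nested_sym)
    ultimately show False by simp
  qed
qed

primrec selected :: "nat \<Rightarrow> 'a sep set" where
  "selected 0 = {}"
| "selected (Suc l) =
     selected l \<union> {s. \<exists>b b'. pair b b' \<and> min_order b b' = l \<and> s \<in> best (selected l) b b'}"

lemma selected_eff: "s \<in> selected l \<Longrightarrow> \<exists>b b'. pair b b' \<and> min_order b b' < l \<and> s \<in> eff b b'"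
  by (induction l) (auto simp: best_def candidates_def less_Suc_eq)

lemma selected_nested: "s \<in> selected l \<Longrightarrow> t \<in> selected l \<Longrightarrow> nested s t"
proof (induction l)
  case (Suc l)
  have new_old: "nested u v" if "u \<in> best (selected l) b b'" "v \<in> selected l" for u v b b'
    using that by (simp add: best_def candidates_def)
  have new: "\<exists>b b'. pair b b' \<and> min_order b b' = l \<and> u \<in> best (selected l) b b'"
    if "u \<in> selected (Suc l)" "u \<notin> selected l" for u
    using that by simp
  consider "s \<in> selected l" "t \<in> selected l" | "s \<notin> selected l" "t \<in> selected l"
    | "s \<in> selected l" "t \<notin> selected l" | "s \<notin> selected l" "t \<notin> selected l"
    by blast
  then show ?case
  proof cases
    case 1
    then show ?thesis by (rule Suc.IH)
  next
    case 2
    then show ?thesis using new[OF Suc.prems(1)] new_old by blast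
  next
    case 3
    then show ?thesis using new[OF Suc.prems(2)] new_old[of t _ _ s] nested_sym[of s t] by blast
  next
    case 4
    then obtain b b' c c' where "pair b b'" "min_order b b' = l" "s \<in> best (selected l) b b'"
      "pair c c'" "min_order c c' = l" "t \<in> best (selected l) c c'"
      using new[OF Suc.prems(1)] new[OF Suc.prems(2)] by blast
    then show ?thesis using best_nested[of b b' c c' s "selected l" t] by simp
  qed
qed simp

lemma selected_mono: "l \<le> m \<Longrightarrow> selected l \<subseteq> selected m"
  by (induction m) (auto simp: le_Suc_eq)

lemma opp_selected: "s \<in> selected l \<Longrightarrow> opp s \<in> selected l"
proof (induction l)
  case (Suc l)
  then show ?case
    using opp_best pair_sym min_order_sym by auto
qed simp

lemma finite_selected: "finite (selected l)"
  using selected_eff effD(1) finite_U by (meson finite_subset subsetI)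

text \<open>
  An efficient separation crossing as few selected ones as possible crosses none: uncrossing it
  from one of them does not create a crossing with another.
\<close>

lemma candidates_nonempty:
  assumes P: "pair b b'"
  shows "candidates (selected (min_order b b')) b b' \<noteq> {}"
proof -
  let ?S = "selected (min_order b b')"
  define cr where "cr s = card {t \<in> ?S. \<not> nested s t}" for s
  obtain s where s: "s \<in> eff b b'" and smin: "\<And>t. t \<in> eff b b' \<Longrightarrow> cr s \<le> cr t"
    using eff_nonempty[OF P] arg_min_natI[of "\<lambda>s. s \<in> eff b b'" _ cr]
      arg_min_nat_le[of "\<lambda>s. s \<in> eff b b'" _ cr] by blast
  have "nested s a" if a: "a \<in> ?S" for a
  proof (rule ccontr)
    assume cross: "\<not> nested s a"
    obtain c c' where "pair c c'" "min_order c c' < min_order b b'" "a \<in> eff c c'"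
      using selected_eff[OF a] by blast
    then obtain t where t: "t \<in> eff b b'" "nested t a"
        "\<And>u. nested u a \<Longrightarrow> nested u s \<Longrightarrow> nested u t"
      using uncross_from_lower_order[OF P _ _ s] by blast
    have "{u \<in> ?S. \<not> nested t u} \<subseteq> {u \<in> ?S. \<not> nested s u}"
      using t(3) a selected_nested nested_sym by blast
    moreover have "a \<in> {u \<in> ?S. \<not> nested s u}" "a \<notin> {u \<in> ?S. \<not> nested t u}"
      using a cross t(2) by auto
    ultimately have "{u \<in> ?S. \<not> nested t u} \<subset> {u \<in> ?S. \<not> nested s u}"
      by blast
    then have "cr t < cr s"
      unfolding cr_def using finite_selected by (intro psubset_card_mono) auto
    then show False using smin[OF t(1)] by simp
  qed
  then have "s \<in> candidates (selected (min_order b b')) b b'" using s by (simp add: candidates_def)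
  then show ?thesis by blast
qed

definition canonical :: "'a sep set" where
  "canonical = selected (Suc k)"

lemma canonical_meets_eff:
  assumes P: "pair b b'"
  shows "canonical \<inter> eff b b' \<noteq> {}"
proof -
  let ?C = "candidates (selected (min_order b b')) b b'"
  obtain s where "s \<in> ?C" "\<And>t. t \<in> ?C \<Longrightarrow> crossing_number s \<le> crossing_number t"
    using candidates_nonempty[OF P] arg_min_natI[of "\<lambda>s. s \<in> ?C" _ crossing_number]
      arg_min_nat_le[of "\<lambda>s. s \<in> ?C" _ crossing_number] by blast
  then have s: "s \<in> best (selected (min_order b b')) b b'" by (simp add: best_def)
  then have "s \<in> selected (Suc (min_order b b'))" using P by auto
  then have "s \<in> canonical"
    using selected_mono[of "Suc (min_order b b')" "Suc k"] min_order_le_k[OF P]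
    by (auto simp: canonical_def simp del: selected.simps)
  then show ?thesis using s by (auto simp: best_def candidates_def)
qed

lemma canonical_eff: "s \<in> canonical \<Longrightarrow> \<exists>b b'. pair b b' \<and> s \<in> eff b b'"
  using selected_eff unfolding canonical_def by blast

lemma canonical_order: "s \<in> canonical \<Longrightarrow> s \<in> U \<and> sep_order s \<le> k"
  using canonical_eff effD min_order_le_k by metis

text \<open>
  Otherwise the separator, of at most \<open>k\<close> vertices, would contain a block. Orientations
  depend on this: with \<open>s \<preceq> opp s\<close>, no consistent orientation could contain \<open>opp s\<close>.
\<close>

lemma canonical_proper: assumes "s \<in> canonical" shows "\<not> s \<preceq> opp s"
proof
  assume le: "s \<preceq> opp s"
  obtain b b' where P: "pair b b'" "s \<in> eff b b'" using canonical_eff[OF assms] by blast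
  have "fst s \<subseteq> snd s" using le by (simp add: sep_le_def)
  then have "b \<subseteq> fst s \<inter> snd s" using effD[OF P(2)] by blast
  moreover have "finite (fst s \<inter> snd s)"
    using effD(1)[OF P(2)] by (rule finite_separator)
  ultimately have "card b \<le> sep_order s" by (simp add: sep_order_def card_mono)
  then show False using canonical_order[OF assms] block_large[of b] P(1) by (simp add: pair_def)
qed

end


section \<open>Symmetries\<close>

definition act :: "('a \<Rightarrow> 'a) \<Rightarrow> 'a sep \<Rightarrow> 'a sep" where
  "act \<alpha> s = (\<alpha> ` fst s, \<alpha> ` snd s)"

lemma act_comp: "act (\<alpha> \<circ> \<beta>) s = act \<alpha> (act \<beta> s)"
  by (simp add: act_def image_comp)

lemma act_id [simp]: "act id = id"
  by (simp add: act_def fun_eq_iff)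

lemma opp_act: "opp (act \<alpha> s) = act \<alpha> (opp s)"
  by (simp add: act_def)

lemma inj_act: "inj \<alpha> \<Longrightarrow> inj (act \<alpha>)"
  by (rule injI) (simp add: act_def prod_eq_iff inj_image_eq_iff)

lemma sep_le_act: "inj \<alpha> \<Longrightarrow> act \<alpha> s \<preceq> act \<alpha> t \<longleftrightarrow> s \<preceq> t"
  by (simp add: act_def sep_le_def inj_image_subset_iff)

lemma nested_act: "inj \<alpha> \<Longrightarrow> nested (act \<alpha> s) (act \<alpha> t) \<longleftrightarrow> nested s t"
  by (simp add: nested_def opp_act sep_le_act)

lemma sep_order_act: "inj \<alpha> \<Longrightarrow> sep_order (act \<alpha> s) = sep_order s"
  unfolding sep_order_def act_def fst_conv snd_conv
  by (metis card_image image_Int inj_on_subset subset_UNIV)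

context block_system
begin

definition symmetry :: "('a \<Rightarrow> 'a) \<Rightarrow> bool" where
  "symmetry \<alpha> \<longleftrightarrow> bij \<alpha> \<and> act \<alpha> ` U = U \<and> (`) \<alpha> ` \<B> = \<B>"

context
  fixes \<alpha> assumes sym: "symmetry \<alpha>"
begin

lemma inj_sym: "inj \<alpha>"
  using sym by (simp add: symmetry_def bij_is_inj)

lemma act_U_iff: "act \<alpha> s \<in> U \<longleftrightarrow> s \<in> U"
proof -
  have "act \<alpha> ` U = U" using sym by (simp add: symmetry_def)
  then show ?thesis using inj_image_mem_iff[OF inj_act[OF inj_sym], of s U] by simp
qed

lemma act_dist_iff: "act \<alpha> s \<in> dist (\<alpha> ` b) (\<alpha> ` b') \<longleftrightarrow> s \<in> dist b b'"
  by (simp add: dist_def act_U_iff) (simp add: act_def inj_image_subset_iff[OF inj_sym])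

lemma act_U_ex: "t \<in> U \<Longrightarrow> \<exists>s\<in>U. t = act \<alpha> s"
  using sym unfolding symmetry_def by blast

lemma min_order_act: "min_order (\<alpha> ` b) (\<alpha> ` b') = min_order b b'"
proof -
  have "(\<exists>s\<in>dist (\<alpha> ` b) (\<alpha> ` b'). sep_order s = n) \<longleftrightarrow> (\<exists>s\<in>dist b b'. sep_order s = n)" for n
  proof
    assume "\<exists>s\<in>dist (\<alpha> ` b) (\<alpha> ` b'). sep_order s = n"
    then obtain t where t: "t \<in> dist (\<alpha> ` b) (\<alpha> ` b')" "sep_order t = n" by blast
    then obtain s where "t = act \<alpha> s" using act_U_ex[of t] by (auto simp: dist_def)
    then show "\<exists>s\<in>dist b b'. sep_order s = n"
      using t act_dist_iff sep_order_act[OF inj_sym] by auto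
  next
    assume "\<exists>s\<in>dist b b'. sep_order s = n"
    then show "\<exists>s\<in>dist (\<alpha> ` b) (\<alpha> ` b'). sep_order s = n"
      using act_dist_iff sep_order_act[OF inj_sym] by blast
  qed
  then show ?thesis by (simp add: min_order_def)
qed

lemma act_eff_iff: "act \<alpha> s \<in> eff (\<alpha> ` b) (\<alpha> ` b') \<longleftrightarrow> s \<in> eff b b'"
  by (simp add: eff_def act_dist_iff min_order_act sep_order_act[OF inj_sym])

lemma crossing_number_act: "crossing_number (act \<alpha> s) = crossing_number s"
proof -
  have "{u \<in> U. \<not> nested u (act \<alpha> s)} = act \<alpha> ` {u \<in> U. \<not> nested u s}"
  proof (intro equalityI subsetI)
    fix t assume t: "t \<in> {u \<in> U. \<not> nested u (act \<alpha> s)}"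
    then obtain u where "t = act \<alpha> u" using act_U_ex[of t] by blast
    then show "t \<in> act \<alpha> ` {u \<in> U. \<not> nested u s}"
      using t by (simp add: act_U_iff nested_act[OF inj_sym])
  qed (auto simp: act_U_iff nested_act[OF inj_sym])
  then show ?thesis
    using card_image[of "act \<alpha>" "{u \<in> U. \<not> nested u s}"] inj_act[OF inj_sym]
    by (simp add: crossing_number_def inj_on_subset)
qed

lemma pair_act: "pair b b' \<Longrightarrow> pair (\<alpha> ` b) (\<alpha> ` b')"
  using sym by (auto simp: pair_def symmetry_def inj_image_eq_iff[OF inj_sym])

lemma act_candidates_iff:
  "act \<alpha> s \<in> candidates (act \<alpha> ` M) (\<alpha> ` b) (\<alpha> ` b') \<longleftrightarrow> s \<in> candidates M b b'"
  by (simp add: candidates_def act_eff_iff nested_act[OF inj_sym])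

lemma act_best: assumes "s \<in> best M b b'" shows "act \<alpha> s \<in> best (act \<alpha> ` M) (\<alpha> ` b) (\<alpha> ` b')"
  unfolding best_def
proof (intro CollectI conjI ballI)
  show "act \<alpha> s \<in> candidates (act \<alpha> ` M) (\<alpha> ` b) (\<alpha> ` b')"
    using assms by (simp add: act_candidates_iff best_def)
  fix t assume t: "t \<in> candidates (act \<alpha> ` M) (\<alpha> ` b) (\<alpha> ` b')"
  then have "t \<in> U" using effD(1) unfolding candidates_def by blast
  then obtain t' where "t = act \<alpha> t'" using act_U_ex by blast
  then show "crossing_number (act \<alpha> s) \<le> crossing_number t"
    using t assms by (simp add: act_candidates_iff best_def crossing_number_act)
qed

end

lemma symmetry_inv: assumes "symmetry \<alpha>" shows "symmetry (inv \<alpha>)"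
proof -
  have b: "bij \<alpha>" and U: "act \<alpha> ` U = U" and B: "(`) \<alpha> ` \<B> = \<B>"
    using assms by (auto simp: symmetry_def)
  have io: "inv \<alpha> \<circ> \<alpha> = id" using b by (simp add: bij_is_inj)
  have "act (inv \<alpha>) ` act \<alpha> ` U = U"
    unfolding image_image act_comp[symmetric] io by simp
  moreover have "(`) (inv \<alpha>) ` (`) \<alpha> ` \<B> = \<B>"
  proof -
    have "(`) (inv \<alpha>) \<circ> (`) \<alpha> = id"
      by (simp add: fun_eq_iff image_inv_f_f[OF bij_is_inj[OF b]])
    then show ?thesis by (metis image_comp image_id id_apply)
  qed
  ultimately show ?thesis
    using U B bij_imp_bij_inv[OF b] by (simp add: symmetry_def)
qed

lemma act_selected: "symmetry \<alpha> \<Longrightarrow> act \<alpha> ` selected l = selected l"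
proof (induction l arbitrary: \<alpha>)
  case (Suc l)
  have sub: "act \<beta> ` selected (Suc l) \<subseteq> selected (Suc l)" if "symmetry \<beta>" for \<beta>
    using act_best[OF that, where M = "selected l"] Suc.IH[OF that] pair_act[OF that]
      min_order_act[OF that] by fastforce
  have "act \<alpha> (act (inv \<alpha>) s) = s" for s
    unfolding act_comp[symmetric]
    using Suc.prems by (metis symmetry_def bij_is_surj surj_iff act_id id_apply)
  then have "selected (Suc l) \<subseteq> act \<alpha> ` selected (Suc l)"
    using sub[OF symmetry_inv[OF Suc.prems]] by (metis image_subset_iff image_eqI subsetI)
  then show ?case using sub[OF Suc.prems] by blast
qed simp

lemma act_canonical: "symmetry \<alpha> \<Longrightarrow> act \<alpha> ` canonical = canonical"
  unfolding canonical_def by (rule act_selected)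

end

section \<open>The tree of orientations of a nested set\<close>

text \<open>
  An orientation containing \<open>(A, B)\<close> points towards \<open>B\<close>. It is consistent if it is closed under
  passing to smaller separations, which have a larger second side.
\<close>

locale nested_system =
  fixes V :: "'a set" and N :: "'a sep set"
  assumes finite_N: "finite N"
    and opp_N: "s \<in> N \<Longrightarrow> opp s \<in> N"
    and N_nested: "s \<in> N \<Longrightarrow> t \<in> N \<Longrightarrow> nested s t"
    and N_proper: "s \<in> N \<Longrightarrow> \<not> s \<preceq> opp s"
    and N_covers: "s \<in> N \<Longrightarrow> fst s \<union> snd s = V"
begin

definition down_closed :: "'a sep set \<Rightarrow> bool" where
  "down_closed Q \<longleftrightarrow> Q \<subseteq> N \<and> (\<forall>s\<in>Q. opp s \<notin> Q) \<and> (\<forall>s\<in>Q. \<forall>t\<in>N. t \<preceq> s \<longrightarrow> t \<in> Q)"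

definition orientation :: "'a sep set \<Rightarrow> bool" where
  "orientation Q \<longleftrightarrow> down_closed Q \<and> (\<forall>s\<in>N. s \<in> Q \<or> opp s \<in> Q)"

definition part :: "'a sep set \<Rightarrow> 'a set" where
  "part Q = {v \<in> V. \<forall>s\<in>Q. v \<in> snd s}"

definition reorient :: "'a sep \<Rightarrow> 'a sep set \<Rightarrow> 'a sep set" where
  "reorient s Q = insert (opp s) (Q - {s})"

lemma opp_neq: "s \<in> N \<Longrightarrow> opp s \<noteq> s"
  using N_proper by fastforce

lemma orientation_sub: "orientation Q \<Longrightarrow> Q \<subseteq> N"
  by (simp add: orientation_def down_closed_def)

lemma orientation_closed: "orientation Q \<Longrightarrow> s \<in> Q \<Longrightarrow> t \<in> N \<Longrightarrow> t \<preceq> s \<Longrightarrow> t \<in> Q"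
  by (auto simp: orientation_def down_closed_def)

lemma orientation_opp: "orientation Q \<Longrightarrow> s \<in> N \<Longrightarrow> opp s \<in> Q \<longleftrightarrow> s \<notin> Q"
  by (auto simp: orientation_def down_closed_def)

text \<open>
  A minimal separation \<open>s\<close> not yet oriented can be added: every \<open>u\<close> strictly below \<open>s\<close> is already
  oriented, and not as \<open>opp u \<in> P\<close>, which would force \<open>opp s\<close> into \<open>P\<close> by closure.
\<close>

lemma extend_to_orientation:
  assumes "down_closed P"
  shows "\<exists>Q. orientation Q \<and> P \<subseteq> Q"
  using assms
proof (induction "card (N - P)" arbitrary: P rule: less_induct)
  case less
  let ?free = "{s \<in> N. s \<notin> P \<and> opp s \<notin> P}"
  show ?case
  proof (cases "?free = {}")
    case True
    then have "orientation P" using less.prems unfolding orientation_def by blast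
    then show ?thesis by blast
  next
    case False
    have fin: "finite ?free" using finite_N by simp
    define below where "below s = card {t \<in> ?free. t \<preceq> s}" for s
    obtain s where s: "s \<in> ?free" and smin: "\<And>t. t \<in> ?free \<Longrightarrow> below s \<le> below t"
      using False arg_min_natI[of "\<lambda>s. s \<in> ?free" _ below]
        arg_min_nat_le[of "\<lambda>s. s \<in> ?free" _ below] by blast
    have minimal: "t = s" if "t \<in> ?free" "t \<preceq> s" for t
    proof (rule ccontr)
      assume "t \<noteq> s"
      then have "s \<notin> {u \<in> ?free. u \<preceq> t}" "s \<in> {u \<in> ?free. u \<preceq> s}"
        using that s sep_le_antisym[of s t] by auto
      moreover have "{u \<in> ?free. u \<preceq> t} \<subseteq> {u \<in> ?free. u \<preceq> s}"
        using that(2) sep_le_trans by blast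
      ultimately have "{u \<in> ?free. u \<preceq> t} \<subset> {u \<in> ?free. u \<preceq> s}" by blast
      then have "below t < below s"
        unfolding below_def by (intro psubset_card_mono finite_subset[OF _ fin]) blast+
      then show False using smin[OF that(1)] by simp
    qed
    have "down_closed (insert s P)"
      unfolding down_closed_def
    proof (intro conjI ballI impI)
      show "insert s P \<subseteq> N" using s less.prems by (auto simp: down_closed_def)
    next
      fix t assume "t \<in> insert s P"
      then show "opp t \<notin> insert s P"
        using s less.prems opp_neq[of s] by (auto simp: down_closed_def)
    next
      fix t u assume t: "t \<in> insert s P" and u: "u \<in> N" "u \<preceq> t"
      show "u \<in> insert s P"
      proof (cases "t = s")
        case True
        have "opp u \<notin> P"
        proof
          assume "opp u \<in> P"
          moreover have "opp s \<preceq> opp u" using u True by (simp add: sep_le_opp_iff)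
          ultimately have "opp s \<in> P"
            using less.prems s opp_N[of s] unfolding down_closed_def by blast
          then show False using s by simp
        qed
        then show ?thesis using minimal[of u] u True by blast
      next
        case False
        then show ?thesis using t u less.prems by (auto simp: down_closed_def)
      qed
    qed
    moreover have "card (N - insert s P) < card (N - P)"
      using s finite_N by (intro psubset_card_mono) auto
    ultimately show ?thesis using less.hyps by (meson insert_subset)
  qed
qed

text \<open>
  Every other separation is comparable with \<open>s\<close> up to reversals, so its orientation is forced by
  the consistency of one of the two ends of the edge. The edge is thus determined by \<open>s\<close>.
\<close>

lemma orientation_at_flipped:
  assumes Q: "orientation Q" "orientation (reorient s Q)" and s: "s \<in> Q"
  shows "Q = {t \<in> N. t \<preceq> s \<or> (t \<preceq> opp s \<and> t \<noteq> opp s)}"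
proof (intro equalityI subsetI)
  have sN: "s \<in> N" using s orientation_sub[OF Q(1)] by blast
  have os: "opp s \<notin> Q" using orientation_opp[OF Q(1) sN] s by simp
  have other: "opp s \<in> reorient s Q" by (simp add: reorient_def)
  fix t
  {
    assume "t \<in> {t \<in> N. t \<preceq> s \<or> (t \<preceq> opp s \<and> t \<noteq> opp s)}"
    then have "t \<in> N" and "t \<preceq> s \<or> (t \<preceq> opp s \<and> t \<noteq> opp s)" by auto
    then show "t \<in> Q"
      using orientation_closed[OF Q(1) s, of t] orientation_closed[OF Q(2) other, of t]
      by (auto simp: reorient_def)
  next
    assume t: "t \<in> Q"
    have tN: "t \<in> N" using t orientation_sub[OF Q(1)] by blast
    have ot: "opp t \<notin> Q" using orientation_opp[OF Q(1) tN] t by simp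
    consider "t \<preceq> s" | "t \<preceq> opp s" | "opp t \<preceq> s" | "opp t \<preceq> opp s"
      using N_nested[OF tN sN] by (auto simp: nested_def)
    then show "t \<in> {t \<in> N. t \<preceq> s \<or> (t \<preceq> opp s \<and> t \<noteq> opp s)}"
    proof cases
      case 3
      then show ?thesis using orientation_closed[OF Q(1) s opp_N[OF tN]] ot by blast
    next
      case 4
      then have "opp t \<in> reorient s Q" using orientation_closed[OF Q(2) other opp_N[OF tN]] by blast
      then have "opp t = opp s" using ot by (auto simp: reorient_def)
      then have "t = s" by (metis swap_swap)
      then show ?thesis using tN by simp
    qed (use t tN os in auto)
  }
qed

lemma parts_across_edge:
  assumes Q: "orientation Q" "orientation (reorient s Q)" and s: "s \<in> Q"
  shows "part Q \<inter> part (reorient s Q) = fst s \<inter> snd s"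
proof
  have sN: "s \<in> N" using s orientation_sub[OF Q(1)] by blast
  show "part Q \<inter> part (reorient s Q) \<subseteq> fst s \<inter> snd s"
    using s by (auto simp: part_def reorient_def)
  have "fst s \<inter> snd s \<subseteq> snd t" if "t \<in> Q" for t
    using that unfolding orientation_at_flipped[OF Q s] by (auto simp: sep_le_def)
  then show "fst s \<inter> snd s \<subseteq> part Q \<inter> part (reorient s Q)"
    using N_covers[OF sN] by (auto simp: part_def reorient_def)
qed

lemma orientation_reorient:
  assumes Q: "orientation Q" and s: "s \<in> Q" and maximal: "\<And>t. t \<in> Q \<Longrightarrow> s \<preceq> t \<Longrightarrow> t = s"
  shows "orientation (reorient s Q)"
  unfolding orientation_def down_closed_def
proof (intro conjI ballI impI)
  have sN: "s \<in> N" using s orientation_sub[OF Q(1)] by blast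
  have os: "opp s \<notin> Q" using orientation_opp[OF Q(1) sN] s by simp
  show "reorient s Q \<subseteq> N"
    using orientation_sub[OF Q] opp_N[OF sN] by (auto simp: reorient_def)
  show "t \<in> reorient s Q \<or> opp t \<in> reorient s Q" if "t \<in> N" for t
    using orientation_opp[OF Q that] by (auto simp: reorient_def)
  fix t assume t: "t \<in> reorient s Q"
  then have tN: "t \<in> N" using orientation_sub[OF Q] opp_N[OF sN] by (auto simp: reorient_def)
  show "opp t \<notin> reorient s Q"
  proof (cases "t = opp s")
    case True
    then show ?thesis using opp_neq[OF sN] by (auto simp: reorient_def)
  next
    case False
    then have "t \<in> Q" "t \<noteq> s" using t by (auto simp: reorient_def)
    moreover have "opp t = opp s \<longrightarrow> t = s" by (metis swap_swap)
    ultimately show ?thesis using orientation_opp[OF Q tN] by (auto simp: reorient_def)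
  qed
  fix u assume u: "u \<in> N" "u \<preceq> t"
  show "u \<in> reorient s Q"
  proof (cases "t = opp s")
    case True
    have "u \<noteq> s" using u True N_proper[OF sN] by auto
    moreover have "u = opp s" if "opp u \<in> Q"
      using maximal[OF that] u True by (auto simp: sep_le_opp_right)
    ultimately show ?thesis using orientation_opp[OF Q u(1)] by (auto simp: reorient_def)
  next
    case False
    then have "t \<in> Q" "t \<noteq> s" using t by (auto simp: reorient_def)
    then have "u \<in> Q" "u \<noteq> s" using orientation_closed[OF Q _ u] maximal[of t] u by auto
    then show ?thesis by (simp add: reorient_def)
  qed
qed

text \<open>
  A maximal element \<open>s\<close> of \<open>Q - R\<close> is maximal in \<open>Q\<close>, because anything above \<open>s\<close> in \<open>R\<close> would force \<open>s\<close>
  into \<open>R\<close>. This is what connects the tree.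
\<close>

lemma ex_reorient_towards:
  assumes Q: "orientation Q" "orientation R" and "Q \<noteq> R"
  shows "\<exists>s\<in>Q - R. orientation (reorient s Q)"
proof -
  have sub: "Q \<subseteq> N" "R \<subseteq> N" using Q orientation_sub by auto
  have "Q - R \<noteq> {}"
  proof
    assume "Q - R = {}"
    moreover have "s \<in> Q" if "s \<in> R" for s
      using that sub \<open>Q - R = {}\<close> orientation_opp[OF Q(1), of s] orientation_opp[OF Q(2), of s] by blast
    ultimately show False using \<open>Q \<noteq> R\<close> by blast
  qed
  define above where "above s = card {t \<in> Q - R. s \<preceq> t}" for s
  obtain s where s: "s \<in> Q - R" and smin: "\<And>t. t \<in> Q - R \<Longrightarrow> above s \<le> above t"
    using \<open>Q - R \<noteq> {}\<close> arg_min_natI[of "\<lambda>s. s \<in> Q - R" _ above]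
      arg_min_nat_le[of "\<lambda>s. s \<in> Q - R" _ above] by blast
  have "t = s" if t: "t \<in> Q" "s \<preceq> t" for t
  proof (rule ccontr)
    assume "t \<noteq> s"
    have "t \<notin> R" using orientation_closed[OF Q(2), of t s] s t sub by blast
    have "s \<notin> {u \<in> Q - R. t \<preceq> u}" "s \<in> {u \<in> Q - R. s \<preceq> u}"
      using \<open>t \<noteq> s\<close> t s sep_le_antisym[of s t] by auto
    moreover have "{u \<in> Q - R. t \<preceq> u} \<subseteq> {u \<in> Q - R. s \<preceq> u}"
      using t(2) sep_le_trans by blast
    ultimately have "{u \<in> Q - R. t \<preceq> u} \<subset> {u \<in> Q - R. s \<preceq> u}" by blast
    then have "above t < above s"
      unfolding above_def using sub
      by (intro psubset_card_mono finite_subset[OF _ finite_N]) blast+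
    then show False using smin[of t] t \<open>t \<notin> R\<close> by simp
  qed
  then show ?thesis using orientation_reorient[OF Q(1)] s by blast
qed

end

lemma ex_arc_leaving:
  assumes "p \<noteq> []" "P (hd p)" "\<not> P (last p)"
  shows "\<exists>(x, y)\<in>set (vwalk_arcs p). P x \<and> \<not> P y"
  using assms
proof (induction p rule: vwalk_arcs.induct)
  case (3 x y xs)
  then show ?case by (cases "P y") auto
qed auto

lemma vwalk_arcs_in_set: "(x, y) \<in> set (vwalk_arcs p) \<Longrightarrow> x \<in> set p \<and> y \<in> set p"
  by (induction p rule: vwalk_arcs.induct) auto

lemma vwalk_arcs_pawalk_verts: "pcas u c v \<Longrightarrow> vwalk_arcs (pawalk_verts u c) = c"
proof (induction c arbitrary: u)
  case (Cons e es)
  then show ?case by (cases es) auto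
qed simp

text \<open>
  The nodes are named by an arbitrary bijection \<open>h\<close> onto the orientations, so that they may have
  any type.
\<close>

locale orientation_tree = nested_system V N for V :: "'a set" and N +
  fixes T :: "'t pair_pre_digraph" and h :: "'t \<Rightarrow> 'a sep set"
  assumes bij_h: "bij_betw h (pverts T) {Q. orientation Q}"
    and arcs_T: "parcs T =
      {(x, y). x \<in> pverts T \<and> y \<in> pverts T \<and> (\<exists>s\<in>h x. h y = reorient s (h x))}"
begin

lemma h_orientation: "x \<in> pverts T \<Longrightarrow> orientation (h x)"
  using bij_h by (auto simp: bij_betw_def)

lemma h_inj: "x \<in> pverts T \<Longrightarrow> y \<in> pverts T \<Longrightarrow> h x = h y \<Longrightarrow> x = y"
  using bij_h by (auto simp: bij_betw_def inj_on_def)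

lemma h_surj: assumes "orientation Q" shows "\<exists>x\<in>pverts T. h x = Q"
proof -
  have "Q \<in> h ` pverts T" using assms bij_betw_imp_surj_on[OF bij_h] by simp
  then show ?thesis by blast
qed

lemma arc_flipE:
  assumes "(x, y) \<in> parcs T"
  obtains s where "x \<in> pverts T" "y \<in> pverts T" "s \<in> h x" "s \<notin> h y" "h y = reorient s (h x)" "s \<in> N"
proof -
  obtain s where s: "x \<in> pverts T" "y \<in> pverts T" "s \<in> h x" "h y = reorient s (h x)"
    using assms arcs_T by auto
  have "s \<in> N" using s orientation_sub h_orientation by blast
  moreover have "s \<notin> h y" using s opp_neq[OF \<open>s \<in> N\<close>] by (simp add: reorient_def)
  ultimately show thesis using s that by blast
qed

lemma arc_of_flip:
  assumes "(x, y) \<in> parcs T" "s \<in> h x" "s \<notin> h y"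
  shows "h y = reorient s (h x)" "orientation (h x)" "orientation (reorient s (h x))"
proof -
  obtain s' where s': "x \<in> pverts T" "y \<in> pverts T" "h y = reorient s' (h x)"
    using arc_flipE[OF assms(1)] by metis
  then have "s' = s" using assms by (auto simp: reorient_def)
  with s' show "h y = reorient s (h x)" by simp
  with s' show "orientation (h x)" "orientation (reorient s (h x))" using h_orientation by metis+
qed

lemma unique_arc:
  assumes "(x, y) \<in> parcs T" "s \<in> h x" "s \<notin> h y"
    and "(x', y') \<in> parcs T" "s \<in> h x'" "s \<notin> h y'"
  shows "x' = x \<and> y' = y"
proof -
  note a = arc_of_flip[OF assms(1-3)] and b = arc_of_flip[OF assms(4-6)]
  have "h x' = h x"
    using orientation_at_flipped[OF a(2,3) assms(2)] orientation_at_flipped[OF b(2,3) assms(5)] by simp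
  then show ?thesis using a b h_inj assms(1,4) by (metis arc_flipE)
qed

lemma arc_sym: assumes "(x, y) \<in> parcs T" shows "(y, x) \<in> parcs T"
proof -
  obtain s where s: "x \<in> pverts T" "y \<in> pverts T" "s \<in> h x" "h y = reorient s (h x)" "s \<in> N"
    using arc_flipE[OF assms] by metis
  have "opp s \<notin> h x" using orientation_opp[OF h_orientation] s by blast
  then have "h x = reorient (opp s) (h y)" using s opp_neq[OF s(5)] by (auto simp: reorient_def)
  moreover have "opp s \<in> h y" using s by (simp add: reorient_def)
  ultimately show ?thesis using s arcs_T by auto
qed

lemma bidirected: "pair_bidirected_digraph T"
proof unfold_locales
  show "fst e \<in> pverts T" "snd e \<in> pverts T" "fst e \<noteq> snd e" if "e \<in> parcs T" for e
    using that by (cases e; auto elim: arc_flipE)+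
  show "symmetric (with_proj T)"
    by (auto simp: symmetric_def intro!: symI arc_sym)
qed

lemma ex_walk:
  assumes "x \<in> pverts T" "y \<in> pverts T"
  shows "(x, y) \<in> rtrancl_on (pverts T) (parcs T)"
  using assms
proof (induction "card (h x - h y)" arbitrary: x rule: less_induct)
  case less
  show ?case
  proof (cases "x = y")
    case True
    then show ?thesis using less by simp
  next
    case False
    then have "h x \<noteq> h y" using h_inj less.prems by blast
    then obtain s where s: "s \<in> h x - h y" "orientation (reorient s (h x))"
      using ex_reorient_towards h_orientation less.prems by blast
    then obtain z where z: "z \<in> pverts T" "h z = reorient s (h x)" using h_surj by blast
    have "s \<in> N" using s(1) orientation_sub[OF h_orientation[OF less.prems(1)]] by blast
    then have "opp s \<in> h y" using s(1) orientation_opp[OF h_orientation[OF less.prems(2)]] by blast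
    then have "h z - h y \<subset> h x - h y" using s(1) z by (auto simp: reorient_def)
    moreover have "finite (h x - h y)"
      using orientation_sub[OF h_orientation[OF less.prems(1)]] finite_N by (meson finite_Diff finite_subset)
    ultimately have "card (h z - h y) < card (h x - h y)" by (rule psubset_card_mono[rotated])
    then have "(z, y) \<in> rtrancl_on (pverts T) (parcs T)" using less.hyps[of z] z less.prems(2) by blast
    moreover have "(x, z) \<in> parcs T" using arcs_T less.prems z s by auto
    ultimately show ?thesis using less.prems by (meson converse_rtrancl_on_into_rtrancl_on)
  qed
qed

lemma ex_vpath:
  assumes "x \<in> pverts T" "y \<in> pverts T"
  shows "\<exists>p. vpath p (with_proj T) \<and> hd p = x \<and> last p = y"
proof -
  interpret pair_bidirected_digraph T by (rule bidirected)
  have "reachable (with_proj T) x y" using ex_walk[OF assms] by (simp add: reachable_def)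
  then show ?thesis using reachable_vpath_conv by blast
qed

lemma connected_T: "connected (with_proj T)"
proof -
  have "down_closed {}" by (simp add: down_closed_def)
  then obtain Q where "orientation Q" using extend_to_orientation by blast
  then have "pverts T \<noteq> {}" using h_surj by blast
  moreover have "(parcs T)\<^sup>s = parcs T"
    using arc_sym by (force simp: symcl_def)
  ultimately show ?thesis using ex_walk unfolding connected_conv with_proj_simps by simp
qed

text \<open>
  The separation reversed by the first arc of a cycle has to be reversed back, but only the inverse
  arc does that. As the cycle has length at least 3, it cannot contain that arc.
\<close>

lemma acyclic_T: "\<not> (\<exists>c. pre_digraph.cycle (with_proj T) c \<and> length c \<ge> 3)"
proof (intro notI, elim exE conjE)
  interpret pair_bidirected_digraph T by (rule bidirected)
  fix c assume "pre_digraph.cycle (with_proj T) c" and len: "length c \<ge> 3"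
  then obtain u where u: "awalk u c u" "distinct (tl (pawalk_verts u c))"
    by (auto simp: cycle_def)
  obtain e r where c: "c = e # r" using len by (cases c) auto
  let ?w = "pawalk_verts (snd e) r"
  have e: "e = (u, snd e)" and arcs: "set c \<subseteq> parcs T" and cas: "pcas (snd e) r u"
    using u(1) c by (auto simp: awalk_def prod_eq_iff)
  have w: "distinct ?w" "vwalk_arcs ?w = r" "?w \<noteq> []" "hd ?w = snd e" "last ?w = u"
    using u(2) c vwalk_arcs_pawalk_verts[OF cas] awhd_if_cas[OF cas] awlast_if_cas[OF cas]
    by auto
  have "length ?w = Suc (length r)"
    using length_awalk_verts by simp
  then have lw: "length ?w \<ge> 3" using len c by simp
  have first_arc: "(u, snd e) \<in> parcs T" using arcs c e by auto
  obtain s where s: "s \<in> h u" "s \<notin> h (snd e)" using arc_flipE[OF first_arc] by metis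
  have "\<exists>(x, y)\<in>set (vwalk_arcs ?w). s \<notin> h x \<and> \<not> s \<notin> h y"
    using w(3-5) s by (intro ex_arc_leaving) simp_all
  then obtain x y where xy: "(x, y) \<in> set r" "s \<notin> h x" "s \<in> h y" using w(2) by auto
  then have "(y, x) \<in> parcs T" using arcs c arc_sym[of x y] by auto
  then have "y = u \<and> x = snd e" using unique_arc[OF first_arc s] xy by blast
  then have return_arc: "(snd e, u) \<in> set (vwalk_arcs ?w)" using xy w by simp
  obtain a b q where abq: "?w = a # b # q" "q \<noteq> []"
    using lw by (cases ?w rule: vwalk_arcs.cases) fastforce+
  then have "a = snd e" "u \<in> set q" using w by (auto split: if_splits)
  have "(a, u) \<notin> set (vwalk_arcs (b # q))"
    using w(1) abq vwalk_arcs_in_set[of a u "b # q"] by auto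
  then have "u = b" using return_arc abq \<open>a = snd e\<close> by auto
  then show False using w(1) abq \<open>u \<in> set q\<close> by auto
qed

lemma undirected_tree_T: "undirected_tree T"
  using bidirected connected_T acyclic_T by (simp add: undirected_tree_def)

text \<open>
  Leaving and re-entering the nodes whose orientation contains \<open>s\<close> would use the same edge of the
  tree twice, and the path would repeat a node.
\<close>

lemma path_convex:
  assumes p: "vpath p (with_proj T)" and t: "t \<in> set p"
    and s: "s \<in> h (hd p)" "s \<in> h (last p)"
  shows "s \<in> h t"
proof (rule ccontr)
  assume st: "s \<notin> h t"
  obtain p1 p2 where p12: "p = p1 @ t # p2" using t by (meson split_list)
  have d: "distinct p" and arcs: "set (vwalk_arcs p) \<subseteq> parcs T" using p by (auto simp: vpath_def vwalk_def)
  have ne: "p1 \<noteq> []" "p2 \<noteq> []" using p12 s st by auto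
  have "\<exists>(x, y)\<in>set (vwalk_arcs (p1 @ [t])). s \<in> h x \<and> \<not> s \<in> h y"
    using s st p12 ne by (intro ex_arc_leaving) auto
  then obtain x y where xy: "(x, y) \<in> set (vwalk_arcs (p1 @ [t]))" "s \<in> h x" "s \<notin> h y" by blast
  have "\<exists>(x, y)\<in>set (vwalk_arcs (t # p2)). s \<notin> h x \<and> \<not> s \<notin> h y"
    using s st p12 ne by (intro ex_arc_leaving) auto
  then obtain y' x' where yx: "(y', x') \<in> set (vwalk_arcs (t # p2))" "s \<in> h x'" "s \<notin> h y'" by blast
  have "set (vwalk_arcs (p1 @ [t])) \<subseteq> set (vwalk_arcs p)"
    using set_vwalk_arcs_append1[of "p1 @ [t]" p2] p12 by simp
  moreover have "set (vwalk_arcs (t # p2)) \<subseteq> set (vwalk_arcs p)"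
    using set_vwalk_arcs_append2[of "t # p2" p1] p12 by simp
  ultimately have "(x, y) \<in> parcs T" "(x', y') \<in> parcs T" using xy yx arcs arc_sym by blast+
  then have "x' = x" using unique_arc xy yx by blast
  moreover have "x \<in> set (p1 @ [t])" "x' \<in> set (t # p2)"
    using vwalk_arcs_in_set xy(1) yx(1) by metis+
  moreover have "x \<noteq> t" using xy st by auto
  ultimately show False using d p12 by auto
qed

text \<open>
  If \<open>v\<close> is not in the side to which \<open>h t\<close> orients \<open>s\<close>, then both ends of the path orient \<open>s\<close> the
  other way, and hence so does \<open>t\<close>.
\<close>

lemma parts_path:
  assumes p: "vpath p (with_proj T)" and t: "t \<in> set p"
  shows "part (h (hd p)) \<inter> part (h (last p)) \<subseteq> part (h t)"
proof
  fix v assume v: "v \<in> part (h (hd p)) \<inter> part (h (last p))"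
  have "set p \<subseteq> pverts T" "p \<noteq> []" using p by (auto simp: vpath_def vwalk_def)
  then have o: "orientation (h (hd p))" "orientation (h (last p))" "orientation (h t)"
    using t h_orientation hd_in_set last_in_set by blast+
  have "v \<in> snd s" if s: "s \<in> h t" for s
  proof (rule ccontr)
    assume "v \<notin> snd s"
    then have "s \<notin> h (hd p)" "s \<notin> h (last p)" using v by (auto simp: part_def)
    moreover have sN: "s \<in> N" using s o orientation_sub by blast
    ultimately have "opp s \<in> h (hd p)" "opp s \<in> h (last p)" using o orientation_opp by blast+
    then have "opp s \<in> h t" by (rule path_convex[OF p t])
    then show False using s orientation_opp[OF o(3) sN] by simp
  qed
  then show "v \<in> part (h t)" using v by (auto simp: part_def)
qed

lemma adhesion_set:
  assumes "(x, y) \<in> parcs T" "s \<in> h x" "s \<notin> h y"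
  shows "part (h x) \<inter> part (h y) = fst s \<inter> snd s"
  using parts_across_edge[OF arc_of_flip(2,3)[OF assms] assms(2)] arc_of_flip(1)[OF assms] by simp

text \<open>
  This serves vertices, edges and blocks alike. Separations whose first side does not contain \<open>X\<close>
  have to point to their second side; when \<open>X\<close> lies in the separator, either direction is fine, and the
  partial orientation is extended.
\<close>

lemma ex_part_containing:
  assumes X: "X \<subseteq> V" and side: "\<And>s. s \<in> N \<Longrightarrow> X \<subseteq> fst s \<or> X \<subseteq> snd s"
  shows "\<exists>x\<in>pverts T. X \<subseteq> part (h x) \<and> (\<forall>s\<in>N. \<not> X \<subseteq> fst s \<longrightarrow> s \<in> h x)"
proof -
  let ?P = "{s \<in> N. \<not> X \<subseteq> fst s}"
  have "down_closed ?P"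
    unfolding down_closed_def
  proof (intro conjI ballI impI)
    fix s assume "s \<in> ?P"
    then show "opp s \<notin> ?P" using side[of s] by auto
  qed (auto simp: sep_le_def)
  then obtain Q where Q: "orientation Q" "?P \<subseteq> Q" using extend_to_orientation by blast
  then obtain x where x: "x \<in> pverts T" "h x = Q" using h_surj by blast
  have "X \<subseteq> snd s" if "s \<in> Q" for s
  proof (rule ccontr)
    assume "\<not> X \<subseteq> snd s"
    moreover have sN: "s \<in> N" using that Q orientation_sub by blast
    ultimately have "opp s \<in> ?P" using opp_N by simp
    then show False using that Q orientation_opp[OF Q(1) sN] by blast
  qed
  then have "X \<subseteq> part (h x)" using x X by (auto simp: part_def)
  then show ?thesis using x Q by blast
qed

lemma path_flips:
  assumes p: "vpath p (with_proj T)" and s: "s \<in> h (hd p)" "s \<notin> h (last p)"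
  shows "\<exists>(x, y)\<in>set (vwalk_arcs p). part (h x) \<inter> part (h y) = fst s \<inter> snd s"
proof -
  have "p \<noteq> []" "set (vwalk_arcs p) \<subseteq> parcs T" using p by (auto simp: vpath_def vwalk_def)
  then show ?thesis using ex_arc_leaving[of p "\<lambda>x. s \<in> h x"] s adhesion_set by fastforce
qed

text \<open>A permutation of the vertices that preserves \<open>N\<close> acts on the tree.\<close>

definition node_act :: "('a \<Rightarrow> 'a) \<Rightarrow> 't \<Rightarrow> 't" where
  "node_act \<alpha> x = (if x \<in> pverts T then inv_into (pverts T) h (act \<alpha> ` h x) else x)"

lemma orientation_act:
  assumes a: "inj \<alpha>" "act \<alpha> ` N = N" and Q: "orientation Q"
  shows "orientation (act \<alpha> ` Q)"
proof -
  have mem: "act \<alpha> s \<in> act \<alpha> ` Q \<longleftrightarrow> s \<in> Q" for s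
    using inj_act[OF a(1)] by (simp add: inj_image_mem_iff)
  have memN: "act \<alpha> s \<in> N \<longleftrightarrow> s \<in> N" for s
    using inj_image_mem_iff[OF inj_act[OF a(1)], of s N] a(2) by simp
  have ex: "\<exists>s\<in>N. t = act \<alpha> s" if "t \<in> N" for t using that a(2) by blast
  show ?thesis
    unfolding orientation_def down_closed_def
  proof (intro conjI ballI impI)
    show "act \<alpha> ` Q \<subseteq> N" using orientation_sub[OF Q] memN by blast
  next
    fix t assume "t \<in> act \<alpha> ` Q"
    then obtain s where s: "t = act \<alpha> s" "s \<in> Q" by blast
    then have "opp s \<notin> Q" using orientation_sub[OF Q] orientation_opp[OF Q] by blast
    then show "opp t \<notin> act \<alpha> ` Q" using mem[of "opp s"] by (simp add: s(1) opp_act)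
  next
    fix s t assume st: "s \<in> act \<alpha> ` Q" "t \<in> N" "t \<preceq> s"
    then show "t \<in> act \<alpha> ` Q"
      using ex[OF st(2)] orientation_closed[OF Q] by (auto simp: sep_le_act[OF a(1)])
  next
    fix t assume "t \<in> N"
    then show "t \<in> act \<alpha> ` Q \<or> opp t \<in> act \<alpha> ` Q"
      using ex[of t] orientation_opp[OF Q] mem opp_act by metis
  qed
qed

lemma reorient_act: "inj \<alpha> \<Longrightarrow> act \<alpha> ` reorient s Q = reorient (act \<alpha> s) (act \<alpha> ` Q)"
  by (simp add: reorient_def opp_act image_set_diff[OF inj_act])

context
  fixes \<alpha> assumes a: "bij \<alpha>" "act \<alpha> ` N = N"
begin

lemma h_node_act: "x \<in> pverts T \<Longrightarrow> h (node_act \<alpha> x) = act \<alpha> ` h x"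
  and node_act_in: "x \<in> pverts T \<Longrightarrow> node_act \<alpha> x \<in> pverts T"
proof -
  assume x: "x \<in> pverts T"
  have "act \<alpha> ` h x \<in> h ` pverts T"
    using orientation_act[OF bij_is_inj[OF a(1)] a(2) h_orientation[OF x]] bij_h
    by (auto simp: bij_betw_def)
  then show "h (node_act \<alpha> x) = act \<alpha> ` h x" "node_act \<alpha> x \<in> pverts T"
    using x by (simp_all add: node_act_def f_inv_into_f inv_into_into)
qed

lemma node_act_arc: "(x, y) \<in> parcs T \<Longrightarrow> (node_act \<alpha> x, node_act \<alpha> y) \<in> parcs T"
  using reorient_act[OF bij_is_inj[OF a(1)]] by (auto simp: arcs_T h_node_act node_act_in)

lemma part_act:
  assumes "\<alpha> ` V = V"
  shows "part (act \<alpha> ` Q) = \<alpha> ` part Q"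
proof -
  have i: "inj \<alpha>" using a by (simp add: bij_is_inj)
  have "\<alpha> v \<in> part (act \<alpha> ` Q) \<longleftrightarrow> v \<in> part Q" for v
    using assms inj_image_mem_iff[OF i, of v V]
    by (simp add: part_def act_def inj_image_mem_iff[OF i])
  moreover have "part (act \<alpha> ` Q) \<subseteq> \<alpha> ` V" using assms by (auto simp: part_def)
  ultimately show ?thesis by blast
qed

end

lemma node_act_id: "node_act id = id"
  using bij_h by (auto simp: node_act_def fun_eq_iff bij_betw_def inv_into_f_f)

lemma node_act_comp:
  assumes a: "bij \<alpha>" "act \<alpha> ` N = N" and b: "bij \<beta>" "act \<beta> ` N = N"
  shows "node_act (\<alpha> \<circ> \<beta>) = node_act \<alpha> \<circ> node_act \<beta>"
proof
  fix x
  show "node_act (\<alpha> \<circ> \<beta>) x = (node_act \<alpha> \<circ> node_act \<beta>) x"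
  proof (cases "x \<in> pverts T")
    case True
    have "act (\<alpha> \<circ> \<beta>) ` h x = act \<alpha> ` act \<beta> ` h x" by (simp add: act_comp image_image)
    then show ?thesis
      using True h_node_act[OF b True] node_act_in[OF b True]
      by (simp add: node_act_def[of "\<alpha> \<circ> \<beta>"] node_act_def[of \<alpha>])
  next
    case False
    then show ?thesis by (simp add: node_act_def)
  qed
qed

lemma node_act_Aut:
  assumes a: "bij \<alpha>" "act \<alpha> ` N = N"
  shows "node_act \<alpha> \<in> Aut T"
proof -
  have io: "inv \<alpha> \<circ> \<alpha> = id" "\<alpha> \<circ> inv \<alpha> = id"
    using a by (simp_all add: bij_is_inj bij_is_surj surj_iff[symmetric])
  have "act (inv \<alpha>) ` act \<alpha> ` N = N"
    unfolding image_image act_comp[symmetric] io by simp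
  then have b: "bij (inv \<alpha>)" "act (inv \<alpha>) ` N = N" using a bij_imp_bij_inv by auto
  have inv: "node_act \<alpha> (node_act (inv \<alpha>) x) = x" "node_act (inv \<alpha>) (node_act \<alpha> x) = x" for x
    using node_act_comp[OF a b] node_act_comp[OF b a] io node_act_id by (metis comp_apply id_apply)+
  have "bij (node_act \<alpha>)" using inv by (metis bijI')
  moreover have "node_act \<alpha> x = x" if "x \<notin> pverts T" for x using that by (simp add: node_act_def)
  ultimately have "node_act \<alpha> permutes pverts T" unfolding permutes_def bij_iff by blast
  moreover have "(node_act \<alpha> x, node_act \<alpha> y) \<in> parcs T \<longleftrightarrow> (x, y) \<in> parcs T" for x y
    using node_act_arc[OF a, of x y] node_act_arc[OF b, of "node_act \<alpha> x" "node_act \<alpha> y"] inv by auto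
  ultimately show ?thesis by (simp add: Aut_def)
qed

end

section \<open>Graphs\<close>

definition separations :: "'a pair_pre_digraph \<Rightarrow> 'a sep set" where
  "separations G = {s. fst s \<union> snd s = pverts G \<and>
     (\<forall>(u, v)\<in>parcs G. {u, v} \<subseteq> fst s \<or> {u, v} \<subseteq> snd s)}"

lemma separator_of_separation:
  assumes s: "s \<in> separations G" and XY: "X \<subseteq> fst s" "Y \<subseteq> snd s"
  shows "separator G X Y (fst s \<inter> snd s)"
  unfolding separator_def
proof (intro conjI allI impI)
  show "fst s \<inter> snd s \<subseteq> pverts G" using s by (auto simp: separations_def)
  fix p assume p: "vpath p (with_proj G) \<and> hd p \<in> X \<and> last p \<in> Y"
  then have ne: "p \<noteq> []" and arcs: "set (vwalk_arcs p) \<subseteq> parcs G"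
    by (auto simp: vpath_def vwalk_def)
  show "set p \<inter> (fst s \<inter> snd s) \<noteq> {}"
  proof (cases "last p \<in> fst s")
    case True
    then show ?thesis using p XY ne last_in_set by blast
  next
    case False
    then obtain x y where xy: "(x, y) \<in> set (vwalk_arcs p)" "x \<in> fst s" "y \<notin> fst s"
      using ex_arc_leaving[of p "\<lambda>x. x \<in> fst s"] ne p XY by blast
    then have "x \<in> snd s" using s arcs by (auto simp: separations_def)
    then show ?thesis using xy vwalk_arcs_in_set[OF xy(1)] by blast
  qed
qed

text \<open>
  One side consists of \<open>S\<close> and the vertices reachable from \<open>X\<close> without meeting \<open>S\<close>, the other of all
  vertices not reached in this way.
\<close>

lemma separation_of_separator:
  assumes G: "pair_graph G" and S: "separator G X Y S" and XY: "X \<subseteq> pverts G" "Y \<subseteq> pverts G"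
  shows "\<exists>s\<in>separations G. X \<subseteq> fst s \<and> Y \<subseteq> snd s \<and> fst s \<inter> snd s = S"
proof -
  interpret pair_graph G by (rule G)
  define R where "R = {v. \<exists>p. vwalk p (with_proj G) \<and> hd p \<in> X \<and> last p = v \<and> set p \<inter> S = {}}"
  have "v \<in> pverts G \<and> v \<notin> S" if v: "v \<in> R" for v
  proof -
    obtain p where p: "vwalk p (with_proj G)" "last p = v" "set p \<inter> S = {}"
      using v by (auto simp: R_def)
    then have "v \<in> set p" "set p \<subseteq> pverts G" by (auto simp: vwalk_def)
    then show ?thesis using p by blast
  qed
  then have R_sub: "R \<subseteq> pverts G" "R \<inter> S = {}" by auto
  have S_sub: "S \<subseteq> pverts G" using S by (simp add: separator_def)
  have step: "v \<in> R" if u: "u \<in> R" and uv: "(u, v) \<in> parcs G" and v: "v \<notin> S" for u v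
  proof -
    obtain p where p: "vwalk p (with_proj G)" "hd p \<in> X" "last p = u" "set p \<inter> S = {}"
      using u by (auto simp: R_def)
    have "p \<noteq> []" using p(1) by (auto simp: vwalk_def)
    then have "vwalk (p @ [v]) (with_proj G)" "hd (p @ [v]) \<in> X" "set (p @ [v]) \<inter> S = {}"
      using p uv v in_arcsD2[OF uv] by (auto simp: vwalk_def set_vwalk_arcs_snoc)
    then show ?thesis unfolding R_def by (intro CollectI exI[of _ "p @ [v]"]) simp
  qed
  let ?s = "(S \<union> R, pverts G - R)"
  have "X \<subseteq> S \<union> R"
  proof
    fix x assume "x \<in> X"
    then have "vwalk [x] (with_proj G)" using XY by (auto simp: vwalk_def)
    then show "x \<in> S \<union> R" using \<open>x \<in> X\<close> unfolding R_def by (cases "x \<in> S") (auto intro: exI[of _ "[x]"])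
  qed
  moreover have "Y \<inter> R = {}"
  proof (rule ccontr)
    assume "Y \<inter> R \<noteq> {}"
    then obtain p where p: "vwalk p (with_proj G)" "hd p \<in> X" "last p \<in> Y" "set p \<inter> S = {}"
      by (auto simp: R_def)
    have "vpath (vwalk_to_vpath p) (with_proj G)" "set (vwalk_to_vpath p) \<inter> S = {}"
      using vwalk_to_vpath_vpath[OF p(1)] vwalk_to_vpath_subset[of _ p] p(4) by blast+
    then show False
      using S p by (auto simp: separator_def vwalk_to_vpath_hd vwalk_to_vpath_last)
  qed
  moreover have "?s \<in> separations G"
  proof -
    have "{u, v} \<subseteq> S \<union> R \<or> {u, v} \<subseteq> pverts G - R" if "(u, v) \<in> parcs G" for u v
      using step[OF _ that] step[OF _ arcs_symmetric[OF that]] in_arcsD1[OF that] in_arcsD2[OF that]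
      by blast
    then show ?thesis using R_sub S_sub by (auto simp: separations_def)
  qed
  moreover have "(S \<union> R) \<inter> (pverts G - R) = S" using R_sub S_sub by blast
  ultimately show ?thesis using XY by (intro bexI[of _ ?s]) auto
qed

text \<open>
  Inseparability in terms of separations alone; its invariance under automorphisms is then
  inherited from that of separations.
\<close>

lemma inseparable_iff:
  assumes G: "pair_graph G"
  shows "inseparable G k X \<longleftrightarrow> X \<subseteq> pverts G \<and> k < card X \<and>
    (\<forall>s\<in>separations G. sep_order s \<le> k \<longrightarrow> X \<subseteq> fst s \<or> X \<subseteq> snd s)"
proof (intro iffI conjI ballI impI)
  assume X: "inseparable G k X"
  show sub: "X \<subseteq> pverts G" and "k < card X" using X by (auto simp: inseparable_def)
  fix s assume s: "s \<in> separations G" "sep_order s \<le> k"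
  show "X \<subseteq> fst s \<or> X \<subseteq> snd s"
  proof (rule ccontr)
    assume "\<not> (X \<subseteq> fst s \<or> X \<subseteq> snd s)"
    then obtain x y where xy: "x \<in> X" "x \<notin> snd s" "y \<in> X" "y \<notin> fst s" by blast
    have cover: "fst s \<union> snd s = pverts G" using s by (simp add: separations_def)
    have "separator G {x} {y} (fst s \<inter> snd s)"
    proof (rule separator_of_separation[OF s(1)])
      have "x \<in> fst s \<union> snd s" "y \<in> fst s \<union> snd s" using xy(1,3) sub cover by auto
      then show "{x} \<subseteq> fst s" "{y} \<subseteq> snd s" using xy(2,4) by auto
    qed
    moreover have "fst s \<inter> snd s \<subseteq> pverts G" "card (fst s \<inter> snd s) \<le> k" "x \<noteq> y"
      using cover s(2) xy sub unfolding sep_order_def by (blast, blast, metis UnE subsetD)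
    moreover have "x \<in> X - fst s \<inter> snd s" "y \<in> X - fst s \<inter> snd s" using xy by auto
    ultimately show False using X unfolding inseparable_def by blast
  qed
next
  assume X: "X \<subseteq> pverts G \<and> k < card X \<and>
    (\<forall>s\<in>separations G. sep_order s \<le> k \<longrightarrow> X \<subseteq> fst s \<or> X \<subseteq> snd s)"
  have "\<not> separator G {x} {y} S"
    if S: "card S \<le> k" and xy: "x \<in> X - S" "y \<in> X - S" for S x y
  proof
    assume sep: "separator G {x} {y} S"
    have "{x} \<subseteq> pverts G" "{y} \<subseteq> pverts G" using xy X by auto
    then obtain s where s: "s \<in> separations G" "x \<in> fst s" "y \<in> snd s" "fst s \<inter> snd s = S"
      using separation_of_separator[OF G sep] by auto
    then have "X \<subseteq> fst s \<or> X \<subseteq> snd s" using X S by (simp add: sep_order_def)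
    then show False using s xy by blast
  qed
  then show "inseparable G k X" using X unfolding inseparable_def by blast
qed

text \<open>
  Two distinct blocks are separated because, by maximality, their union is not inseparable: some
  separation of order at most \<open>k\<close> has neither side containing the union, but has each block on a side.
\<close>

lemma block_system_of_graph:
  assumes G: "pair_graph G"
  shows "block_system (pverts G) (separations G) k {b. block G k b}"
proof
  interpret pair_graph G by (rule G)
  show "finite (pverts G)" by (rule pair_finite_verts)
  show "separations G \<subseteq> Pow (pverts G) \<times> Pow (pverts G)" by (auto simp: separations_def)
  show opp: "opp s \<in> separations G" if "s \<in> separations G" for s
    using that by (auto simp: separations_def)
  show "meet s t \<in> separations G" if "s \<in> separations G" "t \<in> separations G" for s t
    using that unfolding separations_def meet_def by (simp, blast)
  show "k < card b" if "b \<in> {b. block G k b}" for b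
    using that by (simp add: block_def inseparable_def)
  show side: "b \<subseteq> fst s \<or> b \<subseteq> snd s"
    if "b \<in> {b. block G k b}" "s \<in> separations G" "sep_order s \<le> k" for b s
    using that inseparable_iff[OF G] by (simp add: block_def)
  show "\<exists>s\<in>separations G. sep_order s \<le> k \<and> b \<subseteq> fst s \<and> b' \<subseteq> snd s"
    if b: "b \<in> {b. block G k b}" and b': "b' \<in> {b. block G k b}" and "b \<noteq> b'" for b b'
  proof -
    have ins: "inseparable G k b" "inseparable G k b'"
      and max: "\<And>Y. inseparable G k Y \<Longrightarrow> b \<subseteq> Y \<Longrightarrow> Y = b"
        "\<And>Y. inseparable G k Y \<Longrightarrow> b' \<subseteq> Y \<Longrightarrow> Y = b'"
      using b b' by (auto simp: block_def)
    have "\<not> inseparable G k (b \<union> b')"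
      using max[of "b \<union> b'"] \<open>b \<noteq> b'\<close> by blast
    moreover have sub: "b \<union> b' \<subseteq> pverts G" using ins by (auto simp: inseparable_def)
    moreover have "k < card (b \<union> b')"
    proof -
      have "card b \<le> card (b \<union> b')"
        using sub pair_finite_verts by (intro card_mono finite_subset[OF sub]) auto
      then show ?thesis using ins by (simp add: inseparable_def)
    qed
    ultimately obtain s where s: "s \<in> separations G" "sep_order s \<le> k"
      "\<not> b \<union> b' \<subseteq> fst s" "\<not> b \<union> b' \<subseteq> snd s"
      using inseparable_iff[OF G] by blast
    consider "b \<subseteq> fst s" "b' \<subseteq> snd s" | "b \<subseteq> snd s" "b' \<subseteq> fst s"
      using side[OF b s(1,2)] side[OF b' s(1,2)] s(3,4) by (metis Un_least)
    then show ?thesis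
    proof cases
      case 2
      then show ?thesis
        using s(2) opp[OF s(1)] by (intro bexI[of _ "opp s"]) simp_all
    next
      case 1
      then show ?thesis using s(1,2) by blast
    qed
  qed
qed

lemma kappa_eq_min_order:
  assumes G: "pair_graph G" and b: "b \<subseteq> pverts G" "b' \<subseteq> pverts G"
  shows "kappa G b b' = block_system.min_order (separations G) b b'"
proof -
  \<comment> \<open>The minimum order depends on the separations only; any value of \<open>k\<close> gives access to it.\<close>
  interpret block_system "pverts G" "separations G" 0 "{b. block G 0 b}"
    by (rule block_system_of_graph[OF G])
  have "(\<exists>S. separator G b b' S \<and> card S = n) \<longleftrightarrow> (\<exists>s\<in>dist b b'. sep_order s = n)" for n
  proof
    assume "\<exists>S. separator G b b' S \<and> card S = n"
    then obtain S where S: "separator G b b' S" "card S = n" by blast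
    then obtain s where s: "s \<in> separations G" "b \<subseteq> fst s" "b' \<subseteq> snd s" "fst s \<inter> snd s = S"
      using separation_of_separator[OF G S(1) b] by blast
    then have "s \<in> dist b b'" "sep_order s = n" using S(2) by (simp_all add: dist_def sep_order_def)
    then show "\<exists>s\<in>dist b b'. sep_order s = n" by blast
  next
    assume "\<exists>s\<in>dist b b'. sep_order s = n"
    then obtain s where s: "s \<in> separations G" "b \<subseteq> fst s" "b' \<subseteq> snd s"
      and n: "card (fst s \<inter> snd s) = n"
      by (auto simp: dist_def sep_order_def)
    show "\<exists>S. separator G b b' S \<and> card S = n"
      using separator_of_separation[OF s] n by blast
  qed
  then show ?thesis by (simp add: kappa_def min_order_def)
qed

lemma Aut_act_separations:
  assumes "\<alpha> \<in> Aut G" "s \<in> separations G" "pair_graph G"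
  shows "act \<alpha> s \<in> separations G"
proof -
  interpret pair_graph G by fact
  have perm: "\<alpha> permutes pverts G"
    and arcs: "\<And>u v. u \<in> pverts G \<Longrightarrow> v \<in> pverts G \<Longrightarrow> (\<alpha> u, \<alpha> v) \<in> parcs G \<longleftrightarrow> (u, v) \<in> parcs G"
    using assms(1) by (auto simp: Aut_def)
  have s: "fst s \<union> snd s = pverts G"
    "\<And>u v. (u, v) \<in> parcs G \<Longrightarrow> {u, v} \<subseteq> fst s \<or> {u, v} \<subseteq> snd s"
    using assms(2) by (auto simp: separations_def)
  have "\<alpha> ` fst s \<union> \<alpha> ` snd s = pverts G"
    using permutes_image[OF perm] s(1) by (simp flip: image_Un)
  moreover have "{u, v} \<subseteq> \<alpha> ` fst s \<or> {u, v} \<subseteq> \<alpha> ` snd s" if uv: "(u, v) \<in> parcs G" for u v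
  proof -
    have "u \<in> \<alpha> ` pverts G" "v \<in> \<alpha> ` pverts G"
      using permutes_image[OF perm] in_arcsD1[OF uv] in_arcsD2[OF uv] by auto
    then obtain x y where xy: "u = \<alpha> x" "v = \<alpha> y" "x \<in> pverts G" "y \<in> pverts G" by blast
    then have "(x, y) \<in> parcs G" using arcs uv by blast
    then show ?thesis using s(2)[of x y] xy by blast
  qed
  ultimately show ?thesis unfolding separations_def act_def by (simp only: mem_Collect_eq fst_conv snd_conv, blast)
qed

lemma Aut_inv:
  assumes "\<alpha> \<in> Aut G" shows "inv \<alpha> \<in> Aut G"
proof -
  have perm: "\<alpha> permutes pverts G"
    and arcs: "\<And>u v. u \<in> pverts G \<Longrightarrow> v \<in> pverts G \<Longrightarrow> (\<alpha> u, \<alpha> v) \<in> parcs G \<longleftrightarrow> (u, v) \<in> parcs G"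
    using assms by (auto simp: Aut_def)
  have iperm: "inv \<alpha> permutes pverts G" using permutes_inv[OF perm] .
  have "(inv \<alpha> u, inv \<alpha> v) \<in> parcs G \<longleftrightarrow> (u, v) \<in> parcs G" if "u \<in> pverts G" "v \<in> pverts G" for u v
    using arcs[of "inv \<alpha> u" "inv \<alpha> v"] that permutes_in_image[OF iperm]
      permutes_inverses(1)[OF perm] by simp
  then show ?thesis using iperm by (simp add: Aut_def)
qed

lemma Aut_act_inv: "\<alpha> \<in> Aut G \<Longrightarrow> act \<alpha> (act (inv \<alpha>) s) = s"
  unfolding act_comp[symmetric] Aut_def by (metis (no_types, lifting) mem_Collect_eq permutes_inv_o(1) act_id id_apply)

lemma Aut_inseparable:
  assumes G: "pair_graph G" and a: "\<alpha> \<in> Aut G" and X: "inseparable G k X"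
  shows "inseparable G k (\<alpha> ` X)"
proof -
  have perm: "\<alpha> permutes pverts G" using a by (simp add: Aut_def)
  have i: "inj \<alpha>" using permutes_inj[OF perm] .
  have "\<alpha> ` X \<subseteq> pverts G" "card (\<alpha> ` X) = card X"
    using X permutes_image[OF perm] card_image[OF inj_on_subset[OF i]]
    by (auto simp: inseparable_def)
  moreover have "\<alpha> ` X \<subseteq> fst s \<or> \<alpha> ` X \<subseteq> snd s"
    if s: "s \<in> separations G" "sep_order s \<le> k" for s
  proof -
    let ?t = "act (inv \<alpha>) s"
    have t: "act \<alpha> ?t = s" using a by (rule Aut_act_inv)
    have "?t \<in> separations G" using Aut_act_separations[OF Aut_inv[OF a] s(1) G] .
    moreover have "sep_order ?t \<le> k" using sep_order_act[OF i, of ?t] t s(2) by simp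
    ultimately have "X \<subseteq> fst ?t \<or> X \<subseteq> snd ?t" using X inseparable_iff[OF G] by blast
    then have "\<alpha> ` X \<subseteq> fst (act \<alpha> ?t) \<or> \<alpha> ` X \<subseteq> snd (act \<alpha> ?t)"
      unfolding act_def[of \<alpha> ?t] fst_conv snd_conv by blast
    then show ?thesis by (simp only: t)
  qed
  ultimately show ?thesis using X inseparable_iff[OF G] by metis
qed

lemma Aut_block:
  assumes G: "pair_graph G" and a: "\<alpha> \<in> Aut G" and b: "block G k b"
  shows "block G k (\<alpha> ` b)"
  unfolding block_def
proof (rule conjI)
  show "inseparable G k (\<alpha> ` b)" using Aut_inseparable[OF G a] b by (simp add: block_def)
  have perm: "\<alpha> permutes pverts G" using a by (simp add: Aut_def)
  have "Y = \<alpha> ` b" if Y: "inseparable G k Y" "\<alpha> ` b \<subseteq> Y" for Y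
  proof -
    have "inseparable G k (inv \<alpha> ` Y)" using Aut_inseparable[OF G Aut_inv[OF a] Y(1)] .
    moreover have "inv \<alpha> ` \<alpha> ` b \<subseteq> inv \<alpha> ` Y" using Y(2) by (rule image_mono)
    then have "b \<subseteq> inv \<alpha> ` Y" by (simp add: image_inv_f_f[OF permutes_inj[OF perm]])
    ultimately have "inv \<alpha> ` Y = b" using b by (simp add: block_def)
    then have "\<alpha> ` inv \<alpha> ` Y = \<alpha> ` b" by simp
    then show "Y = \<alpha> ` b" by (simp add: image_f_inv_f[OF permutes_surj[OF perm]])
  qed
  then show "\<forall>Y. inseparable G k Y \<and> \<alpha> ` b \<subseteq> Y \<longrightarrow> Y = \<alpha> ` b" by blast
qed

lemma Aut_symmetry:
  assumes G: "pair_graph G" and a: "\<alpha> \<in> Aut G"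
  shows "block_system.symmetry (separations G) {b. block G k b} \<alpha>"
proof -
  interpret block_system "pverts G" "separations G" k "{b. block G k b}"
    by (rule block_system_of_graph[OF G])
  have perm: "\<alpha> permutes pverts G" using a by (simp add: Aut_def)
  have "act \<alpha> ` separations G = separations G"
  proof (intro equalityI subsetI)
    fix s assume "s \<in> separations G"
    then have "act (inv \<alpha>) s \<in> separations G" using Aut_act_separations[OF Aut_inv[OF a] _ G] by blast
    then show "s \<in> act \<alpha> ` separations G" using Aut_act_inv[OF a, of s] by (metis imageI)
  qed (use Aut_act_separations[OF a _ G] in blast)
  moreover have "(`) \<alpha> ` {b. block G k b} = {b. block G k b}"
  proof (intro equalityI subsetI)
    fix b assume "b \<in> {b. block G k b}"
    then have "inv \<alpha> ` b \<in> {b. block G k b}" using Aut_block[OF G Aut_inv[OF a]] by simp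
    moreover have "b = \<alpha> ` inv \<alpha> ` b" by (simp add: image_f_inv_f[OF permutes_surj[OF perm]])
    ultimately show "b \<in> (`) \<alpha> ` {b. block G k b}" by (metis imageI)
  qed (use Aut_block[OF G a] in blast)
  ultimately show ?thesis using permutes_bij[OF perm] by (simp add: symmetry_def)
qed


section \<open>The tree-decomposition\<close>

theorem theorem1:
  fixes G :: "'a pair_pre_digraph" and k :: nat
  assumes "pair_graph G"
  shows "\<exists>(T :: nat pair_pre_digraph) V.
    tree_decomposition G T V \<and> adhesion T V \<le> k \<and> Aut_invariant G T V \<and>
    (\<forall>b1 b2. block G k b1 \<and> block G k b2 \<and> b1 \<noteq> b2 \<longrightarrow> efficiently_distinguishes G T V b1 b2)"
proof -
  interpret B: block_system "pverts G" "separations G" k "{b. block G k b}"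
    by (rule block_system_of_graph[OF assms])
  let ?N = "B.canonical"
  have N_sep: "s \<in> separations G" "sep_order s \<le> k" if "s \<in> ?N" for s
    using B.canonical_order[OF that] by auto
  interpret N: nested_system "pverts G" ?N
  proof
    show "finite ?N" unfolding B.canonical_def by (rule B.finite_selected)
    show "opp s \<in> ?N" if "s \<in> ?N" for s
      using that B.opp_selected by (simp add: B.canonical_def del: B.selected.simps)
    show "nested s t" if "s \<in> ?N" "t \<in> ?N" for s t
      using that unfolding B.canonical_def by (rule B.selected_nested)
    show "\<not> s \<preceq> opp s" if "s \<in> ?N" for s using that by (rule B.canonical_proper)
    show "fst s \<union> snd s = pverts G" if "s \<in> ?N" for s
      using N_sep(1)[OF that] by (simp add: separations_def)
  qed
  let ?O = "{Q. N.orientation Q}"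
  have "?O \<subseteq> Pow ?N" using N.orientation_sub by blast
  then have "finite ?O" using N.finite_N by (meson finite_Pow_iff finite_subset)
  then obtain h where h: "bij_betw h {0..<card ?O} ?O" using ex_bij_betw_nat_finite by blast
  define T where "T = \<lparr>pverts = {0..<card ?O}, parcs = {(x, y). x \<in> {0..<card ?O} \<and>
    y \<in> {0..<card ?O} \<and> (\<exists>s\<in>h x. h y = N.reorient s (h x))}\<rparr>"
  interpret T: orientation_tree "pverts G" ?N T h
    by unfold_locales (simp_all add: T_def h)
  define V where "V x = N.part (h x)" for x

  have V_sub: "V x \<subseteq> pverts G" for x by (auto simp: V_def N.part_def)
  have td: "tree_decomposition G T V"
    unfolding tree_decomposition_def
  proof (intro conjI)
    show "undirected_tree T" by (rule T.undirected_tree_T)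
    have "\<exists>t\<in>pverts T. v \<in> V t" if v: "v \<in> pverts G" for v
    proof -
      have "{v} \<subseteq> fst s \<or> {v} \<subseteq> snd s" if "s \<in> ?N" for s
        using N.N_covers[OF that] v by blast
      moreover have "{v} \<subseteq> pverts G" using v by simp
      ultimately obtain t where "t \<in> pverts T" "{v} \<subseteq> N.part (h t)"
        using T.ex_part_containing[of "{v}"] by metis
      then show ?thesis unfolding V_def by blast
    qed
    then show "pverts G = (\<Union>t\<in>pverts T. V t)" using V_sub by blast
    have "\<exists>t\<in>pverts T. u \<in> V t \<and> v \<in> V t" if uv: "(u, v) \<in> parcs G" for u v
    proof -
      interpret pair_graph G by (rule assms)
      have "{u, v} \<subseteq> pverts G" using in_arcsD1[OF uv] in_arcsD2[OF uv] by simp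
      moreover have "{u, v} \<subseteq> fst s \<or> {u, v} \<subseteq> snd s" if "s \<in> ?N" for s
        using N_sep(1)[OF that] uv unfolding separations_def by blast
      ultimately obtain t where "t \<in> pverts T" "{u, v} \<subseteq> N.part (h t)"
        using T.ex_part_containing[of "{u, v}"] by metis
      then show ?thesis unfolding V_def by blast
    qed
    then show "\<forall>(u, v)\<in>parcs G. \<exists>t\<in>pverts T. u \<in> V t \<and> v \<in> V t" by blast
    show "\<forall>p. vpath p (with_proj T) \<longrightarrow> (\<forall>t\<in>set p. V (hd p) \<inter> V (last p) \<subseteq> V t)"
      using T.parts_path by (simp add: V_def)
  qed

  have adh: "adhesion T V \<le> k"
  proof (cases "parcs T = {}")
    case False
    have le: "card A \<le> k" if A: "A \<in> adhesion_sets T V" for A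
    proof -
      obtain x y where xy: "(x, y) \<in> parcs T" "A = V x \<inter> V y"
        using A unfolding adhesion_sets_def by blast
      obtain s where s: "s \<in> h x" "s \<notin> h y" "s \<in> ?N" using T.arc_flipE[OF xy(1)] by metis
      have "A = fst s \<inter> snd s" using T.adhesion_set[OF xy(1) s(1,2)] xy(2) by (simp add: V_def)
      then show ?thesis using N_sep(2)[OF s(3)] by (simp add: sep_order_def)
    qed
    have "adhesion_sets T V \<subseteq> Pow (pverts G)" using V_sub by (auto simp: adhesion_sets_def)
    then have "finite (adhesion_sets T V)" using B.finite_V by (meson finite_Pow_iff finite_subset)
    moreover have "adhesion_sets T V \<noteq> {}" using False by (auto simp: adhesion_sets_def)
    ultimately show ?thesis using False le by (simp add: adhesion_def)
  qed (simp add: adhesion_def)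

  have sym: "bij \<alpha>" "act \<alpha> ` ?N = ?N" "\<alpha> ` pverts G = pverts G" if "\<alpha> \<in> Aut G" for \<alpha>
  proof -
    have perm: "\<alpha> permutes pverts G" using that by (simp add: Aut_def)
    show "bij \<alpha>" "\<alpha> ` pverts G = pverts G" using permutes_bij[OF perm] permutes_image[OF perm] .
    show "act \<alpha> ` ?N = ?N" using B.act_canonical[OF Aut_symmetry[OF assms that]] .
  qed
  have inv: "Aut_invariant G T V"
    unfolding Aut_invariant_def
  proof (intro exI[of _ T.node_act] conjI ballI)
    show "T.node_act \<alpha> \<in> Aut T" if "\<alpha> \<in> Aut G" for \<alpha>
      using T.node_act_Aut[OF sym(1,2)[OF that]] .
    show "T.node_act id = id" by (rule T.node_act_id)
    show "T.node_act (\<alpha> \<circ> \<beta>) = T.node_act \<alpha> \<circ> T.node_act \<beta>" if "\<alpha> \<in> Aut G" "\<beta> \<in> Aut G" for \<alpha> \<beta>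
      using T.node_act_comp[OF sym(1,2)[OF that(1)] sym(1,2)[OF that(2)]] .
    show "V (T.node_act \<alpha> t) = \<alpha> ` V t" if a: "\<alpha> \<in> Aut G" and "t \<in> pverts T" for \<alpha> t
      unfolding V_def T.h_node_act[OF sym(1,2)[OF a] that(2)]
      by (rule T.part_act[OF sym[OF a]])
  qed

  have "efficiently_distinguishes G T V b1 b2"
    if b: "block G k b1" "block G k b2" "b1 \<noteq> b2" for b1 b2
  proof -
    have sub: "b1 \<subseteq> pverts G" "b2 \<subseteq> pverts G" using b by (auto simp: block_def inseparable_def)
    have P: "B.pair b1 b2" using b by (simp add: B.pair_def)
    obtain s where s: "s \<in> ?N" "s \<in> B.eff b1 b2" using B.canonical_meets_eff[OF P] by blast
    have side: "b \<subseteq> fst s \<or> b \<subseteq> snd s" if "block G k b" "s \<in> ?N" for b s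
      using B.block_side[of b s] that N_sep by simp
    \<comment> \<open>A block lies on only one side of \<open>s\<close>, so the orientation of \<open>s\<close> at the node of a block is
      forced to point to that block.\<close>
    have not_both: "\<not> (b \<subseteq> fst s \<and> b \<subseteq> snd s)" if "block G k b" for b
    proof
      assume "b \<subseteq> fst s \<and> b \<subseteq> snd s"
      then have "card b \<le> sep_order s"
        unfolding sep_order_def using B.finite_separator[OF N_sep(1)[OF s(1)]] by (intro card_mono) auto
      then show False using N_sep(2)[OF s(1)] B.block_large[of b] that by simp
    qed
    obtain t1 where t1: "t1 \<in> pverts T" "b1 \<subseteq> V t1" "\<And>s. s \<in> ?N \<Longrightarrow> \<not> b1 \<subseteq> fst s \<Longrightarrow> s \<in> h t1"
      using T.ex_part_containing[OF sub(1) side[OF b(1)]] unfolding V_def by metis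
    obtain t2 where t2: "t2 \<in> pverts T" "b2 \<subseteq> V t2" "\<And>s. s \<in> ?N \<Longrightarrow> \<not> b2 \<subseteq> fst s \<Longrightarrow> s \<in> h t2"
      using T.ex_part_containing[OF sub(2) side[OF b(2)]] unfolding V_def by metis
    have "s \<in> h t2" using t2(3)[OF s(1)] not_both[OF b(2)] B.effD(3)[OF s(2)] by blast
    moreover have "opp s \<in> h t1"
      using t1(3)[OF N.opp_N[OF s(1)]] not_both[OF b(1)] B.effD(2)[OF s(2)] by auto
    ultimately have flip: "opp s \<in> h t1" "opp s \<notin> h t2"
      using N.orientation_opp[OF T.h_orientation[OF t2(1)] s(1)] by auto
    then have "t1 \<noteq> t2" by blast
    then have d: "distinguishes_at T V t1 t2 b1 b2" using t1 t2 by (simp add: distinguishes_at_def)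
    obtain p where p: "vpath p (with_proj T)" "hd p = t1" "last p = t2"
      using T.ex_vpath[OF t1(1) t2(1)] by blast
    obtain x y where xy: "(x, y) \<in> set (vwalk_arcs p)" "V x \<inter> V y = fst (opp s) \<inter> snd (opp s)"
      using T.path_flips[OF p(1), of "opp s"] flip p unfolding V_def by blast
    have "card (V x \<inter> V y) = sep_order s"
      using xy(2) by (simp add: sep_order_def Int_commute)
    also have "\<dots> = kappa G b1 b2"
      using B.effD(4)[OF s(2)] kappa_eq_min_order[OF assms sub] by simp
    finally show ?thesis
      using d p xy(1) unfolding efficiently_distinguishes_def by blast
  qed
  then show ?thesis using td adh inv by blast
qed

end
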